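(* Let $\mathcal{A}$ be an essentially small hereditary abelian category, linear over the finite field $\mathbf{k}=\mathbb{F}_q$, with finite morphism and extension spaces, and assume $K_0(\mathcal{A})$ is a free abelian group. There exists an algebra epimorphism from the extended $\Delta$-Hall algebra to the $\Delta$-Hall algebra, $$\widetilde{\Phi}:\widetilde{\mathcal{H}}_{\Delta}(\mathcal{A})\longrightarrow\mathcal{H}_{\Delta}(\mathcal{A}),\qquad[M][K_\alpha]\longmapsto[M],$$ whose kernel is the ideal $\mathrm{Ker}\,\widetilde{\Phi}=\langle[K_\alpha]-1\mid\alpha\in K_0(\mathcal{A})\rangle$ generated by the elements $[K_\alpha]-1$.
   Context: $\mathbf{v}=\sqrt{q}$; $\mathrm{Iso}(\mathcal{A})$ is the set of isomorphism classes of objects; $a_M=|\mathrm{Aut}(M)|$; $\widehat{M}$ is the class of $M$ in $K_0(\mathcal{A})$. Let $F_{AB}^M=|\{X\subseteq M\mid X\cong B,\ M/X\cong A\}|$, $\langle M,N\rangle=\dim_{\mathbf{k}}\mathrm{Hom}_{\mathcal{A}}(M,N)-\dim_{\mathbf{k}}\mathrm{Ext}^1_{\mathcal{A}}(M,N)$, $\langle L,I,N\rangle=\langle L,I\rangle+\langle I,I\rangle+\langle I,N\rangle-\langle L,N\rangle$, and $$\widehat{F}^M_{AB}=\sum_{[L],[I],[N]}\mathbf{v}^{\langle L,I,N\rangle}\frac{a_La_Ia_N}{a_M}F_{LI}^BF_{NL}^MF_{IN}^A .$$ $\mathcal{H}_\Delta(\mathcal{A})$ is the associative $\mathbb{Q}(\mathbf{v})$-algebra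 with basis $\{[M]\mid[M]\in\mathrm{Iso}(\mathcal{A})\}$, product $[A]*[B]=\sum_{[M]}\widehat{F}_{AB}^M[M]$ and unit $[0]$. $\widetilde{\mathcal{H}}_\Delta(\mathcal{A})$ is the associative $\mathbb{Q}(\mathbf{v})$-algebra with basis $\{[M][K_\alpha]\mid[M]\in\mathrm{Iso}(\mathcal{A}),\alpha\in K_0(\mathcal{A})\}$, product $[A][K_\alpha]*[B][K_\beta]=\sum_{[M]}\widehat{F}_{AB}^M[M][K_{\frac{\widehat{A}+\widehat{B}-\widehat{M}}{2}+\alpha+\beta}]$ (if $\widehat{F}_{AB}^M\ne0$ then $\frac{\widehat{A}+\widehat{B}-\widehat{M}}{2}\in K_0(\mathcal{A})$) and unit $1=[0][K_0]$. Here $[K_\alpha]$ stands for $[0][K_\alpha]$. *)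

theory Defs
  imports
    Complex_Main
    "HOL-Library.Cardinality"
    "HOL-Algebra.Free_Abelian_Groups"
    "HOL-Algebra.Generated_Fields"
    "Jordan_Normal_Form.VS_Connect"
begin

section \<open>Linear categories\<close>

text \<open>
  Objects and morphisms form sets, so a category here is small. An essentially small category
  is equivalent to a small one, and everything below is invariant under equivalence.
\<close>

record ('o, 'm, 'k) lin_cat =
  Obj :: "'o set"
  Arr :: "'m set"
  Dom :: "'m \<Rightarrow> 'o"
  Cod :: "'m \<Rightarrow> 'o"
  Ident :: "'o \<Rightarrow> 'm"
  Comp :: "'m \<Rightarrow> 'm \<Rightarrow> 'm" (infixr "\<cdot>\<index>" 75)
  Plus :: "'m \<Rightarrow> 'm \<Rightarrow> 'm" (infixl "\<boxplus>\<index>" 65)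
  Null :: "'o \<Rightarrow> 'o \<Rightarrow> 'm"
  Scal :: "'k \<Rightarrow> 'm \<Rightarrow> 'm"

definition homs :: "('o, 'm, 'k) lin_cat \<Rightarrow> 'o \<Rightarrow> 'o \<Rightarrow> 'm set" where
  "homs C X Y = {f \<in> Arr C. Dom C f = X \<and> Cod C f = Y}"

text \<open>Vector spaces are \<open>module\<close> records, whose ring multiplication is irrelevant.\<close>

definition hom_space :: "('o, 'm, 'k) lin_cat \<Rightarrow> 'o \<Rightarrow> 'o \<Rightarrow> ('k, 'm) module" where
  "hom_space C X Y =
    \<lparr>carrier = homs C X Y, mult = undefined, one = undefined,
     zero = Null C X Y, add = Plus C, smult = Scal C\<rparr>"

locale linear_category =
  fixes C :: "('o, 'm, 'k::field) lin_cat" (structure)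
  assumes dom_cod: "f \<in> Arr C \<Longrightarrow> Dom C f \<in> Obj C \<and> Cod C f \<in> Obj C"
    and ident: "X \<in> Obj C \<Longrightarrow> Ident C X \<in> homs C X X"
    and comp: "\<lbrakk>f \<in> homs C X Y; g \<in> homs C Y Z\<rbrakk> \<Longrightarrow> g \<cdot> f \<in> homs C X Z"
    and comp_assoc: "\<lbrakk>f \<in> homs C W X; g \<in> homs C X Y; h \<in> homs C Y Z\<rbrakk>
      \<Longrightarrow> (h \<cdot> g) \<cdot> f = h \<cdot> (g \<cdot> f)"
    and ident_left: "f \<in> homs C X Y \<Longrightarrow> Ident C Y \<cdot> f = f"
    and ident_right: "f \<in> homs C X Y \<Longrightarrow> f \<cdot> Ident C X = f"
    and hom_vectorspace: "\<lbrakk>X \<in> Obj C; Y \<in> Obj C\<rbrakk>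
      \<Longrightarrow> vectorspace class_ring (hom_space C X Y)"
    and comp_plus_left: "\<lbrakk>f \<in> homs C X Y; g \<in> homs C Y Z; g' \<in> homs C Y Z\<rbrakk>
      \<Longrightarrow> (g \<boxplus> g') \<cdot> f = (g \<cdot> f) \<boxplus> (g' \<cdot> f)"
    and comp_plus_right: "\<lbrakk>f \<in> homs C X Y; f' \<in> homs C X Y; g \<in> homs C Y Z\<rbrakk>
      \<Longrightarrow> g \<cdot> (f \<boxplus> f') = (g \<cdot> f) \<boxplus> (g \<cdot> f')"
    and comp_scal_left: "\<lbrakk>f \<in> homs C X Y; g \<in> homs C Y Z\<rbrakk>
      \<Longrightarrow> Scal C c g \<cdot> f = Scal C c (g \<cdot> f)"
    and comp_scal_right: "\<lbrakk>f \<in> homs C X Y; g \<in> homs C Y Z\<rbrakk>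
      \<Longrightarrow> g \<cdot> Scal C c f = Scal C c (g \<cdot> f)"


section \<open>Abelian categories\<close>

definition monic :: "('o, 'm, 'k) lin_cat \<Rightarrow> 'm \<Rightarrow> bool" where
  "monic C f \<longleftrightarrow> f \<in> Arr C \<and>
    (\<forall>W. \<forall>g\<in>homs C W (Dom C f). \<forall>h\<in>homs C W (Dom C f).
       f \<cdot>\<^bsub>C\<^esub> g = f \<cdot>\<^bsub>C\<^esub> h \<longrightarrow> g = h)"

definition epic :: "('o, 'm, 'k) lin_cat \<Rightarrow> 'm \<Rightarrow> bool" where
  "epic C f \<longleftrightarrow> f \<in> Arr C \<and>
    (\<forall>W. \<forall>g\<in>homs C (Cod C f) W. \<forall>h\<in>homs C (Cod C f) W.
       g \<cdot>\<^bsub>C\<^esub> f = h \<cdot>\<^bsub>C\<^esub> f \<longrightarrow> g = h)"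

definition is_kernel :: "('o, 'm, 'k) lin_cat \<Rightarrow> 'm \<Rightarrow> 'm \<Rightarrow> bool" where
  "is_kernel C k f \<longleftrightarrow> f \<in> Arr C \<and> k \<in> Arr C \<and> Cod C k = Dom C f \<and>
    f \<cdot>\<^bsub>C\<^esub> k = Null C (Dom C k) (Cod C f) \<and>
    (\<forall>W. \<forall>g\<in>homs C W (Dom C f). f \<cdot>\<^bsub>C\<^esub> g = Null C W (Cod C f) \<longrightarrow>
       (\<exists>!u. u \<in> homs C W (Dom C k) \<and> k \<cdot>\<^bsub>C\<^esub> u = g))"

definition is_cokernel :: "('o, 'm, 'k) lin_cat \<Rightarrow> 'm \<Rightarrow> 'm \<Rightarrow> bool" where
  "is_cokernel C p f \<longleftrightarrow> f \<in> Arr C \<and> p \<in> Arr C \<and> Dom C p = Cod C f \<and>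
    p \<cdot>\<^bsub>C\<^esub> f = Null C (Dom C f) (Cod C p) \<and>
    (\<forall>W. \<forall>g\<in>homs C (Cod C f) W. g \<cdot>\<^bsub>C\<^esub> f = Null C (Dom C f) W \<longrightarrow>
       (\<exists>!u. u \<in> homs C (Cod C p) W \<and> u \<cdot>\<^bsub>C\<^esub> p = g))"

definition zero_object :: "('o, 'm, 'k) lin_cat \<Rightarrow> 'o \<Rightarrow> bool" where
  "zero_object C Z \<longleftrightarrow> Z \<in> Obj C \<and>
    (\<forall>X\<in>Obj C. (\<exists>!f. f \<in> homs C X Z) \<and> (\<exists>!f. f \<in> homs C Z X))"

definition is_biproduct ::
  "('o, 'm, 'k) lin_cat \<Rightarrow> 'o \<Rightarrow> 'o \<Rightarrow> 'o \<Rightarrow> 'm \<Rightarrow> 'm \<Rightarrow> 'm \<Rightarrow> 'm \<Rightarrow> bool" where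
  "is_biproduct C X Y S i1 i2 p1 p2 \<longleftrightarrow>
    i1 \<in> homs C X S \<and> i2 \<in> homs C Y S \<and> p1 \<in> homs C S X \<and> p2 \<in> homs C S Y \<and>
    p1 \<cdot>\<^bsub>C\<^esub> i1 = Ident C X \<and> p2 \<cdot>\<^bsub>C\<^esub> i2 = Ident C Y \<and>
    p1 \<cdot>\<^bsub>C\<^esub> i2 = Null C Y X \<and> p2 \<cdot>\<^bsub>C\<^esub> i1 = Null C X Y \<and>
    (i1 \<cdot>\<^bsub>C\<^esub> p1) \<boxplus>\<^bsub>C\<^esub> (i2 \<cdot>\<^bsub>C\<^esub> p2) = Ident C S"

locale abelian_category = linear_category +
  assumes ex_zero_object: "\<exists>Z. zero_object C Z"
    and ex_biproduct: "\<lbrakk>X \<in> Obj C; Y \<in> Obj C\<rbrakk>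
      \<Longrightarrow> \<exists>S i1 i2 p1 p2. is_biproduct C X Y S i1 i2 p1 p2"
    and ex_kernel: "f \<in> Arr C \<Longrightarrow> \<exists>k. is_kernel C k f"
    and ex_cokernel: "f \<in> Arr C \<Longrightarrow> \<exists>p. is_cokernel C p f"
    and monic_is_kernel: "monic C f \<Longrightarrow> \<exists>g. is_kernel C f g"
    and epic_is_cokernel: "epic C f \<Longrightarrow> \<exists>g. is_cokernel C f g"

definition isomorphism :: "('o, 'm, 'k) lin_cat \<Rightarrow> 'm \<Rightarrow> bool" where
  "isomorphism C u \<longleftrightarrow> u \<in> Arr C \<and>
    (\<exists>w\<in>homs C (Cod C u) (Dom C u).
       w \<cdot>\<^bsub>C\<^esub> u = Ident C (Dom C u) \<and> u \<cdot>\<^bsub>C\<^esub> w = Ident C (Cod C u))"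

definition iso_rel :: "('o, 'm, 'k) lin_cat \<Rightarrow> ('o \<times> 'o) set" where
  "iso_rel C = {(X, Y). X \<in> Obj C \<and> Y \<in> Obj C \<and> (\<exists>u\<in>homs C X Y. isomorphism C u)}"

definition Iso :: "('o, 'm, 'k) lin_cat \<Rightarrow> 'o set set" where
  "Iso C = Obj C // iso_rel C"

definition rep :: "'o set \<Rightarrow> 'o" where
  "rep c = (SOME X. X \<in> c)"

definition short_exact :: "('o, 'm, 'k) lin_cat \<Rightarrow> 'm \<Rightarrow> 'm \<Rightarrow> bool" where
  "short_exact C i p \<longleftrightarrow> is_kernel C i p \<and> is_cokernel C p i"


section \<open>Yoneda extension groups\<close>

text \<open>Exactness at the middle object: the image of \<open>f\<close> is the kernel of \<open>g\<close>.\<close>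

definition exact_at :: "('o, 'm, 'k) lin_cat \<Rightarrow> 'm \<Rightarrow> 'm \<Rightarrow> bool" where
  "exact_at C f g \<longleftrightarrow>
    (\<exists>k e. is_kernel C k g \<and> epic C e \<and> Cod C e = Dom C k \<and> f = k \<cdot>\<^bsub>C\<^esub> e)"

text \<open>
  The \<open>n\<close>-extensions \<open>0 \<rightarrow> N \<rightarrow> E\<^sub>1 \<rightarrow> \<dots> \<rightarrow> E\<^sub>n \<rightarrow> M \<rightarrow> 0\<close>, for \<open>n \<ge> 1\<close>, given by the list
  of their \<open>n + 1\<close> arrows other than those from and to \<open>0\<close>.
\<close>

definition extensions :: "('o, 'm, 'k) lin_cat \<Rightarrow> nat \<Rightarrow> 'o \<Rightarrow> 'o \<Rightarrow> 'm list set" where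
  "extensions C n M N = {d. length d = Suc n \<and> Dom C (d ! 0) = N \<and> Cod C (d ! n) = M \<and>
     monic C (d ! 0) \<and> (\<forall>i<n. exact_at C (d ! i) (d ! Suc i)) \<and> epic C (d ! n)}"

definition ext_morphism ::
  "('o, 'm, 'k) lin_cat \<Rightarrow> nat \<Rightarrow> (nat \<Rightarrow> 'm) \<Rightarrow> 'm list \<Rightarrow> 'm list \<Rightarrow> bool" where
  "ext_morphism C n h d e \<longleftrightarrow>
    (\<forall>i\<le>n. h i \<in> homs C (Dom C (d ! i)) (Dom C (e ! i))) \<and>
    h (Suc n) \<in> homs C (Cod C (d ! n)) (Cod C (e ! n)) \<and>
    (\<forall>i\<le>n. h (Suc i) \<cdot>\<^bsub>C\<^esub> (d ! i) = (e ! i) \<cdot>\<^bsub>C\<^esub> h i)"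

definition ext_step :: "('o, 'm, 'k) lin_cat \<Rightarrow> nat \<Rightarrow> 'o \<Rightarrow> 'o \<Rightarrow> 'm list rel" where
  "ext_step C n M N = {(d, e). d \<in> extensions C n M N \<and> e \<in> extensions C n M N \<and>
     (\<exists>h. ext_morphism C n h d e \<and> h 0 = Ident C N \<and> h (Suc n) = Ident C M)}"

definition Ext :: "('o, 'm, 'k) lin_cat \<Rightarrow> nat \<Rightarrow> 'o \<Rightarrow> 'o \<Rightarrow> 'm list set set" where
  "Ext C n M N = extensions C n M N // (ext_step C n M N \<union> (ext_step C n M N)\<inverse>)\<^sup>*"

text \<open>
  Baer sum: \<open>z\<close> is the push-out along the codiagonal of \<open>N\<close> of the pull-back \<open>w\<close> along the
  diagonal of \<open>M\<close> of the direct sum of the extensions \<open>x\<close> and \<open>y\<close> of \<open>M\<close> by \<open>N\<close>.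
  Push-outs and pull-backs of extensions are recognised by the morphisms of extensions
  whose component on the other end is the identity.
\<close>

definition baer_sum ::
  "('o, 'm, 'k) lin_cat \<Rightarrow> 'o \<Rightarrow> 'o \<Rightarrow> 'm list \<Rightarrow> 'm list \<Rightarrow> 'm list \<Rightarrow> bool" where
  "baer_sum C M N x y z \<longleftrightarrow>
    (\<exists>N2 i1 i2 p1 p2 E j1 j2 q1 q2 M2 k1 k2 r1 r2 w h h'.
       is_biproduct C N N N2 i1 i2 p1 p2 \<and>
       is_biproduct C (Cod C (x ! 0)) (Cod C (y ! 0)) E j1 j2 q1 q2 \<and>
       is_biproduct C M M M2 k1 k2 r1 r2 \<and>
       w \<in> extensions C 1 M N2 \<and>
       ext_morphism C 1 h w
         [(j1 \<cdot>\<^bsub>C\<^esub> (x ! 0) \<cdot>\<^bsub>C\<^esub> p1) \<boxplus>\<^bsub>C\<^esub> (j2 \<cdot>\<^bsub>C\<^esub> (y ! 0) \<cdot>\<^bsub>C\<^esub> p2),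
          (k1 \<cdot>\<^bsub>C\<^esub> (x ! 1) \<cdot>\<^bsub>C\<^esub> q1) \<boxplus>\<^bsub>C\<^esub> (k2 \<cdot>\<^bsub>C\<^esub> (y ! 1) \<cdot>\<^bsub>C\<^esub> q2)] \<and>
       h 0 = Ident C N2 \<and> h 2 = k1 \<boxplus>\<^bsub>C\<^esub> k2 \<and>
       ext_morphism C 1 h' w z \<and> h' 0 = p1 \<boxplus>\<^bsub>C\<^esub> p2 \<and> h' 2 = Ident C M)"

text \<open>
  The vector space \<open>Ext\<^sup>1(M, N)\<close>: the zero is the class of the split extensions, and a scalar
  acts by push-out along its multiple of the identity of \<open>N\<close>.
\<close>

definition ext_space :: "('o, 'm, 'k) lin_cat \<Rightarrow> 'o \<Rightarrow> 'o \<Rightarrow> ('k, 'm list set) module" where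
  "ext_space C M N =
    \<lparr>carrier = Ext C 1 M N, mult = undefined, one = undefined,
     zero = {z \<in> extensions C 1 M N.
       \<exists>s\<in>homs C M (Dom C (z ! 1)). (z ! 1) \<cdot>\<^bsub>C\<^esub> s = Ident C M},
     add = (\<lambda>c d. {z \<in> extensions C 1 M N. \<exists>x\<in>c. \<exists>y\<in>d. baer_sum C M N x y z}),
     smult = (\<lambda>a c. {z \<in> extensions C 1 M N. \<exists>x\<in>c. \<exists>h.
       ext_morphism C 1 h x z \<and> h 0 = Scal C a (Ident C N) \<and> h 2 = Ident C M})\<rparr>"

text \<open>\<open>Ext\<^sup>n(M, N)\<close> always contains the class of the zero extension, so it vanishes iff it has
  exactly one element.\<close>

definition hereditary :: "('o, 'm, 'k) lin_cat \<Rightarrow> bool" where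
  "hereditary C \<longleftrightarrow> (\<forall>n\<ge>2. \<forall>M\<in>Obj C. \<forall>N\<in>Obj C. is_singleton (Ext C n M N))"

definition finitary :: "('o, 'm, 'k) lin_cat \<Rightarrow> bool" where
  "finitary C \<longleftrightarrow> (\<forall>M\<in>Obj C. \<forall>N\<in>Obj C. finite (homs C M N) \<and> finite (Ext C 1 M N))"


section \<open>The Grothendieck group\<close>

text \<open>Written multiplicatively, following the conventions for quotient groups.\<close>

definition K0_relations :: "('o, 'm, 'k) lin_cat \<Rightarrow> ('o \<Rightarrow>\<^sub>0 int) set" where
  "K0_relations C = generate (free_Abelian_group (Obj C))
     {frag_of (Cod C i) - frag_of (Dom C i) - frag_of (Cod C p) | i p. short_exact C i p}"

definition K0 :: "('o, 'm, 'k) lin_cat \<Rightarrow> ('o \<Rightarrow>\<^sub>0 int) set monoid" where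
  "K0 C = free_Abelian_group (Obj C) Mod K0_relations C"

definition K0_class :: "('o, 'm, 'k) lin_cat \<Rightarrow> 'o \<Rightarrow> ('o \<Rightarrow>\<^sub>0 int) set" where
  "K0_class C M = K0_relations C #>\<^bsub>free_Abelian_group (Obj C)\<^esub> frag_of M"

text \<open>
  There is no loss in taking the basis \<open>S\<close> inside the type of elements of \<open>K0 C\<close>.
\<close>

definition K0_free :: "('o, 'm, 'k) lin_cat \<Rightarrow> bool" where
  "K0_free C \<longleftrightarrow> (\<exists>S :: ('o \<Rightarrow>\<^sub>0 int) set set. K0 C \<cong> free_Abelian_group S)"

text \<open>Halves are unique when they exist and \<open>K0 C\<close> is torsion-free.\<close>

definition K0_half :: "('o, 'm, 'k) lin_cat \<Rightarrow> ('o \<Rightarrow>\<^sub>0 int) set \<Rightarrow> ('o \<Rightarrow>\<^sub>0 int) set" where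
  "K0_half C x = (THE d. d \<in> carrier (K0 C) \<and> d \<otimes>\<^bsub>K0 C\<^esub> d = x)"


section \<open>Structure constants\<close>

definition hall_v :: "('o, 'm, 'k::finite) lin_cat \<Rightarrow> real" where
  "hall_v C = sqrt (real CARD('k))"

definition aut_card :: "('o, 'm, 'k) lin_cat \<Rightarrow> 'o \<Rightarrow> nat" where
  "aut_card C M = card {u \<in> homs C M M. isomorphism C u}"

definition euler :: "('o, 'm, 'k::field) lin_cat \<Rightarrow> 'o \<Rightarrow> 'o \<Rightarrow> int" where
  "euler C M N = int (vectorspace.dim (class_ring :: 'k ring) (hom_space C M N))
     - int (vectorspace.dim (class_ring :: 'k ring) (ext_space C M N))"

definition euler3 :: "('o, 'm, 'k::field) lin_cat \<Rightarrow> 'o \<Rightarrow> 'o \<Rightarrow> 'o \<Rightarrow> int" where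
  "euler3 C L I N = euler C L I + euler C I I + euler C I N - euler C L N"

text \<open>
  Subobjects of \<open>M\<close> are monomorphisms into \<open>M\<close> up to isomorphism over \<open>M\<close>. \<open>hall_number C A B M\<close>
  counts those isomorphic to \<open>B\<close> with quotient isomorphic to \<open>A\<close>.
\<close>

definition sub_monos :: "('o, 'm, 'k) lin_cat \<Rightarrow> 'o \<Rightarrow> 'o \<Rightarrow> 'o \<Rightarrow> 'm set" where
  "sub_monos C A B M = {i. monic C i \<and> Cod C i = M \<and> (Dom C i, B) \<in> iso_rel C \<and>
     (\<exists>p. is_cokernel C p i \<and> (Cod C p, A) \<in> iso_rel C)}"

definition same_subobject :: "('o, 'm, 'k) lin_cat \<Rightarrow> 'm rel" where
  "same_subobject C = {(i, j). monic C i \<and> monic C j \<and>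
     (\<exists>u\<in>homs C (Dom C i) (Dom C j). isomorphism C u \<and> i = j \<cdot>\<^bsub>C\<^esub> u)}"

definition hall_number :: "('o, 'm, 'k) lin_cat \<Rightarrow> 'o \<Rightarrow> 'o \<Rightarrow> 'o \<Rightarrow> nat" where
  "hall_number C A B M = card (sub_monos C A B M // same_subobject C)"

text \<open>
  Only finitely many triples contribute: \<open>I\<close> is the image, \<open>N\<close> the kernel and \<open>L\<close> the
  cokernel of a morphism from \<open>A\<close> to \<open>B\<close>.
\<close>

definition hatF :: "('o, 'm, 'k::{field,finite}) lin_cat \<Rightarrow> 'o \<Rightarrow> 'o \<Rightarrow> 'o \<Rightarrow> real" where
  "hatF C A B M =
    (\<Sum>(L, I, N) \<in> {(l, i, n). l \<in> Iso C \<and> i \<in> Iso C \<and> n \<in> Iso C \<and>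
         hall_number C (rep l) (rep i) B * hall_number C (rep n) (rep l) M *
         hall_number C (rep i) (rep n) A \<noteq> 0}.
       hall_v C powi euler3 C (rep L) (rep I) (rep N) *
       (real (aut_card C (rep L)) * real (aut_card C (rep I)) * real (aut_card C (rep N)) /
         real (aut_card C M)) *
       real (hall_number C (rep L) (rep I) B) *
       real (hall_number C (rep N) (rep L) M) *
       real (hall_number C (rep I) (rep N) A))"


section \<open>The two algebras\<close>

text \<open>The field of coefficients, as a subfield of the reals.\<close>

definition Qv :: "('o, 'm, 'k::finite) lin_cat \<Rightarrow> real ring" where
  "Qv C = class_ring \<lparr>carrier := generate_field class_ring {hall_v C}\<rparr>"

definition zero_iso_class :: "('o, 'm, 'k) lin_cat \<Rightarrow> 'o set" where
  "zero_iso_class C = {Z. zero_object C Z}"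

text \<open>
  Elements are finitely supported families of coefficients. The support \<open>{M. hatF \<dots> \<noteq> 0}\<close> of
  a product of basis elements is finite when \<open>C\<close> is finitary: \<open>M\<close> is then an extension of
  \<open>N\<close> by \<open>L\<close>, for one of finitely many pairs \<open>(L, N)\<close>.
\<close>

definition delta_hall :: "('o, 'm, 'k::{field,finite}) lin_cat \<Rightarrow> (real, 'o set \<Rightarrow>\<^sub>0 real) module"
  where
  "delta_hall C =
    \<lparr>carrier = {x. Poly_Mapping.keys x \<subseteq> Iso C \<and>
       range (Poly_Mapping.lookup x) \<subseteq> carrier (Qv C)},
     mult = (\<lambda>x y. \<Sum>A\<in>Poly_Mapping.keys x. \<Sum>B\<in>Poly_Mapping.keys y.
       \<Sum>M\<in>{M \<in> Iso C. hatF C (rep A) (rep B) (rep M) \<noteq> 0}.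
         Poly_Mapping.single M
           (Poly_Mapping.lookup x A * Poly_Mapping.lookup y B *
             hatF C (rep A) (rep B) (rep M))),
     one = Poly_Mapping.single (zero_iso_class C) 1,
     zero = 0,
     add = (+),
     smult = (\<lambda>c. Poly_Mapping.map ((*) c))\<rparr>"

text \<open>The index \<open>(M, \<alpha>)\<close> stands for the basis element \<open>[M][K\<^sub>\<alpha>]\<close>.\<close>

definition ext_delta_hall ::
  "('o, 'm, 'k::{field,finite}) lin_cat \<Rightarrow>
    (real, ('o set \<times> ('o \<Rightarrow>\<^sub>0 int) set) \<Rightarrow>\<^sub>0 real) module" where
  "ext_delta_hall C =
    \<lparr>carrier = {x. Poly_Mapping.keys x \<subseteq> Iso C \<times> carrier (K0 C) \<and>
       range (Poly_Mapping.lookup x) \<subseteq> carrier (Qv C)},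
     mult = (\<lambda>x y. \<Sum>(A, \<alpha>)\<in>Poly_Mapping.keys x. \<Sum>(B, \<beta>)\<in>Poly_Mapping.keys y.
       \<Sum>M\<in>{M \<in> Iso C. hatF C (rep A) (rep B) (rep M) \<noteq> 0}.
         Poly_Mapping.single
           (M, K0_half C (K0_class C (rep A) \<otimes>\<^bsub>K0 C\<^esub> K0_class C (rep B)
                 \<otimes>\<^bsub>K0 C\<^esub> inv\<^bsub>K0 C\<^esub> K0_class C (rep M))
               \<otimes>\<^bsub>K0 C\<^esub> \<alpha> \<otimes>\<^bsub>K0 C\<^esub> \<beta>)
           (Poly_Mapping.lookup x (A, \<alpha>) * Poly_Mapping.lookup y (B, \<beta>) *
             hatF C (rep A) (rep B) (rep M))),
     one = Poly_Mapping.single (zero_iso_class C, \<one>\<^bsub>K0 C\<^esub>) 1,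
     zero = 0,
     add = (+),
     smult = (\<lambda>c. Poly_Mapping.map ((*) c))\<rparr>"


section \<open>Homomorphisms and ideals of algebras\<close>

text \<open>
  The \<open>algebra\<close> locale of the library covers only commutative algebras, and its \<open>genideal\<close>
  has the ring axioms, hence associativity, built in. The notions below are the standard ones
  for a unital algebra over \<open>K\<close> and need no such prerequisite.
\<close>

definition algebra_hom ::
  "'a ring \<Rightarrow> ('a, 'b) module \<Rightarrow> ('a, 'c) module \<Rightarrow> ('b \<Rightarrow> 'c) \<Rightarrow> bool" where
  "algebra_hom K A B f \<longleftrightarrow> linear_map K A B f \<and> f \<in> Ring.ring_hom A B"

definition algebra_epi ::
  "'a ring \<Rightarrow> ('a, 'b) module \<Rightarrow> ('a, 'c) module \<Rightarrow> ('b \<Rightarrow> 'c) \<Rightarrow> bool" where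
  "algebra_epi K A B f \<longleftrightarrow> algebra_hom K A B f \<and> f ` carrier A = carrier B"

definition algebra_ideal :: "'a ring \<Rightarrow> ('a, 'b) module \<Rightarrow> 'b set \<Rightarrow> bool" where
  "algebra_ideal K A I \<longleftrightarrow> submodule K I A \<and>
    (\<forall>a\<in>I. \<forall>x\<in>carrier A. x \<otimes>\<^bsub>A\<^esub> a \<in> I \<and> a \<otimes>\<^bsub>A\<^esub> x \<in> I)"

definition generated_ideal :: "'a ring \<Rightarrow> ('a, 'b) module \<Rightarrow> 'b set \<Rightarrow> 'b set" where
  "generated_ideal K A S = \<Inter>{I. algebra_ideal K A I \<and> S \<subseteq> I}"

end

theory Submission
  imports Defs
begin

text \<open>The epimorphism forgets the second index, and forgetting it turns one multiplication into
the other. Its kernel is spanned by the elements \<open>[M][K\<^sub>\<alpha>] - [M]\<close>. Because \<open>hatF\<close> of \<open>A\<close>, \<open>0\<close> and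
\<open>M\<close> vanishes unless \<open>M = A\<close>, the product of \<open>[M]\<close> and \<open>[K\<^sub>\<alpha>] - 1\<close> is the multiple of
\<open>[M][K\<^sub>\<alpha>] - [M]\<close> by \<open>k = hatF C M 0 M\<close>. For the kernel to be generated by the \<open>[K\<^sub>\<alpha>] - 1\<close> it is
enough that \<open>k \<noteq> 0\<close>, so the Euler form never has to be evaluated.\<close>

section \<open>Linear extension\<close>

text \<open>The spanning of the kernel comes from the linear section of the forgetful map that sends
  [M] to [M][K_0]: subtracting from x the section of its image turns every term into a multiple of
  some [M][K_\<alpha>] - [M][K_0], and leaves x unchanged when its image is 0. The vanishing of
  \<open>hatF\<close> is forced by the triples (L, I, N): for B = 0 the objects I and L are a
  subobject and a quotient of 0, so N is isomorphic to both A and M and a single triple is left. The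
  obstacle lies in the exponents. \<open>K0_half\<close> is a definite description, so the extended
  product is known to stay in its carrier only once a half has been exhibited, namely the class of
  I, and shown to be unique, which is torsion-freeness of a free group. Finally, coefficients are
  real numbers confined to Q(v), so k has to lie in Q(v) before a scalar of the algebra can be
  divided by it.\<close>

definition lin_ext :: "('a \<Rightarrow> 'b::zero \<Rightarrow> 'c::comm_monoid_add) \<Rightarrow> ('a \<Rightarrow>\<^sub>0 'b) \<Rightarrow> 'c" where
  "lin_ext g x = (\<Sum>k\<in>Poly_Mapping.keys x. g k (Poly_Mapping.lookup x k))"

lemma lin_ext_zero [simp]: "lin_ext g 0 = 0"
  by (simp add: lin_ext_def)

lemma lin_ext_superset:
  assumes "finite S" "Poly_Mapping.keys x \<subseteq> S" "\<And>k. g k 0 = 0"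
  shows "lin_ext g x = (\<Sum>k\<in>S. g k (Poly_Mapping.lookup x k))"
  unfolding lin_ext_def
  by (rule sum.mono_neutral_left) (use assms in \<open>auto simp: in_keys_iff\<close>)

context
  fixes g :: "'a \<Rightarrow> 'b::ab_group_add \<Rightarrow> 'c::ab_group_add"
  assumes g: "\<And>k. additive (g k)"
begin

text \<open>Terms of x and y may cancel, so the three sums are compared over the union of the two
  supports; this is harmless because additivity gives \<open>g k 0 = 0\<close>.\<close>

lemma lin_ext_add: "lin_ext g (x + y) = lin_ext g x + lin_ext g y"
proof -
  let ?S = "Poly_Mapping.keys x \<union> Poly_Mapping.keys y"
  have z: "g k 0 = 0" for k by (rule additive.zero[OF g])
  have "lin_ext g (x + y) = (\<Sum>k\<in>?S. g k (Poly_Mapping.lookup (x + y) k))"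
    by (rule lin_ext_superset) (auto simp: z keys_add)
  also have "\<dots> = (\<Sum>k\<in>?S. g k (Poly_Mapping.lookup x k)) + (\<Sum>k\<in>?S. g k (Poly_Mapping.lookup y k))"
    by (simp add: lookup_add additive.add[OF g] sum.distrib)
  also have "\<dots> = lin_ext g x + lin_ext g y"
    by (simp add: lin_ext_superset[of ?S] z)
  finally show ?thesis .
qed

lemma lin_ext_single: "lin_ext g (Poly_Mapping.single k c) = g k c"
  by (simp add: lin_ext_def additive.zero[OF g])

lemma lin_ext_sum: "lin_ext g (\<Sum>i\<in>A. u i) = (\<Sum>i\<in>A. lin_ext g (u i))"
  by (induction A rule: infinite_finite_induct) (simp_all add: lin_ext_add)

lemma lin_ext_diff: "lin_ext g (x - y) = lin_ext g x - lin_ext g y"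
  using lin_ext_add[of "x - y" y] by simp

end

lemma additive_single: "additive (Poly_Mapping.single k)"
  by (rule additive.intro) (rule single_add)

lemma lin_ext_id: "lin_ext Poly_Mapping.single (x :: 'a \<Rightarrow>\<^sub>0 'b::ab_group_add) = x"
  by (rule poly_mapping_eqI)
    (auto simp: lin_ext_def lookup_sum lookup_single when_def in_keys_iff)

text \<open>Push-forward of finitely supported families along a map of indices, adding up the
  coefficients in each fibre. For \<open>fst\<close> it is the map that forgets K_\<alpha>.\<close>

definition push :: "('a \<Rightarrow> 'b) \<Rightarrow> ('a \<Rightarrow>\<^sub>0 'c::ab_group_add) \<Rightarrow> ('b \<Rightarrow>\<^sub>0 'c)" where
  "push f = lin_ext (\<lambda>p. Poly_Mapping.single (f p))"

lemma push_single [simp]: "push f (Poly_Mapping.single p c) = Poly_Mapping.single (f p) c"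
  unfolding push_def by (rule lin_ext_single) (rule additive_single)

lemma push_zero [simp]: "push f 0 = 0"
  by (simp add: push_def)

lemma push_add: "push f (x + y) = push f x + push f y"
  unfolding push_def by (rule lin_ext_add) (rule additive_single)

lemma push_diff: "push f (x - y) = push f x - push f y"
  unfolding push_def by (rule lin_ext_diff) (rule additive_single)

lemma push_sum: "push f (\<Sum>i\<in>A. u i) = (\<Sum>i\<in>A. push f (u i))"
  unfolding push_def by (rule lin_ext_sum) (rule additive_single)

lemma push_lin_ext: "push f (lin_ext g x) = lin_ext (\<lambda>k c. push f (g k c)) x"
  by (simp add: lin_ext_def push_sum)

text \<open>Change of variables. Coefficients over one fibre of f are merged on the left and kept
  apart on the right; additivity of each \<open>g k\<close> reconciles the two.\<close>

lemma lin_ext_push: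
  assumes "\<And>k. additive (g k)"
  shows "lin_ext g (push f x) = lin_ext (\<lambda>p. g (f p)) x"
  using assms
  by (simp add: push_def lin_ext_def[of "\<lambda>p. Poly_Mapping.single (f p)"] lin_ext_sum lin_ext_single)
    (simp add: lin_ext_def)

lemma lookup_map_times:
  "Poly_Mapping.lookup (Poly_Mapping.map ((*) (c::'b::mult_zero)) x) k = c * Poly_Mapping.lookup x k"
  by (simp add: Poly_Mapping.map.rep_eq when_def)

lemma map_times_zero [simp]: "Poly_Mapping.map ((*) (c::'b::mult_zero)) 0 = 0"
  by (rule poly_mapping_eqI) (simp add: lookup_map_times)

lemma push_map_times:
  "push f (Poly_Mapping.map ((*) (c::'b::ring)) x) = Poly_Mapping.map ((*) c) (push f x)"
proof -
  \<comment> \<open>Scaling may annihilate coefficients, so the sum for the scaled family is taken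
    over the possibly larger support of x.\<close>
  have "push f (Poly_Mapping.map ((*) c) x)
      = (\<Sum>k\<in>Poly_Mapping.keys x.
          Poly_Mapping.single (f k) (Poly_Mapping.lookup (Poly_Mapping.map ((*) c) x) k))"
    unfolding push_def by (rule lin_ext_superset) (auto simp: lookup_map_times in_keys_iff)
  then show ?thesis
    by (intro poly_mapping_eqI)
      (auto simp: push_def lin_ext_def lookup_map_times lookup_sum sum_distrib_left lookup_single
        when_def intro!: sum.cong)
qed

section \<open>Coefficients in a subfield\<close>

locale real_subfield =
  fixes F :: "real set"
  assumes sub: "subfield F class_ring"
begin

lemma zero_mem [simp]: "0 \<in> F" and one_mem [simp]: "1 \<in> F"
  and times_mem: "a \<in> F \<Longrightarrow> b \<in> F \<Longrightarrow> a * b \<in> F"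
  and add_mem: "a \<in> F \<Longrightarrow> b \<in> F \<Longrightarrow> a + b \<in> F"
  and uminus_mem: "a \<in> F \<Longrightarrow> - a \<in> F"
  using subringE(2,3,6,7,5)[OF subfieldE(1)[OF sub]] by (simp_all add: class_ring_simps)

text \<open>Inversion of reals is total with \<open>inverse 0 = 0\<close>, so membership of 0
  settles that case and quotients and integer powers can be treated uniformly.\<close>

lemma inverse_mem: "a \<in> F \<Longrightarrow> inverse a \<in> F"
  using ring.subfield_m_inv(1,2)[OF class_ring.ring_axioms sub, of a] inverse_unique[of a]
  by (cases "a = 0") force+

lemma sum_mem: "(\<And>i. i \<in> A \<Longrightarrow> f i \<in> F) \<Longrightarrow> sum f A \<in> F"
  by (induction A rule: infinite_finite_induct) (simp_all add: add_mem)

lemma of_nat_mem: "real n \<in> F"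
  by (induction n) (simp_all add: add_mem)

lemma power_mem: "a \<in> F \<Longrightarrow> a ^ n \<in> F"
  by (induction n) (simp_all add: times_mem)

lemma powi_mem: "a \<in> F \<Longrightarrow> a powi n \<in> F"
  by (simp add: power_int_def power_mem inverse_mem)

lemma divide_mem: "a \<in> F \<Longrightarrow> b \<in> F \<Longrightarrow> a / b \<in> F"
  by (simp add: divide_inverse times_mem inverse_mem)

text \<open>The type allows all real coefficients, so the restriction to the subfield is a condition
  on families. Both carriers have this shape, with S the set of basis indices.\<close>

definition combos :: "'b set \<Rightarrow> ('b \<Rightarrow>\<^sub>0 real) set" where
  "combos S = {x. Poly_Mapping.keys x \<subseteq> S \<and> range (Poly_Mapping.lookup x) \<subseteq> F}"

lemma combosI: "Poly_Mapping.keys x \<subseteq> S \<Longrightarrow> (\<And>k. Poly_Mapping.lookup x k \<in> F) \<Longrightarrow> x \<in> combos S"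
  by (auto simp: combos_def)

lemma combosD: "x \<in> combos S \<Longrightarrow> k \<in> Poly_Mapping.keys x \<Longrightarrow> k \<in> S"
  "x \<in> combos S \<Longrightarrow> Poly_Mapping.lookup x k \<in> F"
  by (auto simp: combos_def)

lemma zero_combos [simp]: "0 \<in> combos S"
  by (rule combosI) simp_all

lemma add_combos: "x \<in> combos S \<Longrightarrow> y \<in> combos S \<Longrightarrow> x + y \<in> combos S"
  using keys_add[of x y] by (auto simp: combos_def lookup_add intro!: add_mem)

lemma uminus_combos: "x \<in> combos S \<Longrightarrow> - x \<in> combos S"
  by (auto simp: combos_def in_keys_iff intro!: uminus_mem)

lemma map_times_combos: "c \<in> F \<Longrightarrow> x \<in> combos S \<Longrightarrow> Poly_Mapping.map ((*) c) x \<in> combos S"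
  by (rule combosI) (auto simp: combos_def lookup_map_times in_keys_iff intro!: times_mem)

lemma single_combos: "s \<in> S \<Longrightarrow> c \<in> F \<Longrightarrow> Poly_Mapping.single s c \<in> combos S"
  by (rule combosI) (auto simp: lookup_single when_def split: if_splits)

lemma sum_combos: "(\<And>i. i \<in> A \<Longrightarrow> u i \<in> combos S) \<Longrightarrow> (\<Sum>i\<in>A. u i) \<in> combos S"
  by (induction A rule: infinite_finite_induct) (simp_all add: add_combos)

lemma push_combos:
  assumes "x \<in> combos S" "f ` S \<subseteq> T"
  shows "push f x \<in> combos T"
  unfolding push_def lin_ext_def
  using assms by (intro sum_combos single_combos) (auto dest: combosD)

text \<open>Multiplication and unit of the record are left open, so that both algebras are
  instances.\<close>

lemma vectorspace_combos:
  fixes V :: "(real, 'b \<Rightarrow>\<^sub>0 real) module"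
  assumes V: "carrier V = combos S" "add V = (+)" "zero V = 0"
    "smult V = (\<lambda>c. Poly_Mapping.map ((*) c))"
  shows "vectorspace (class_ring\<lparr>carrier := F\<rparr>) V"
proof -
  have F: "field (class_ring\<lparr>carrier := F\<rparr>)"
    by (rule ring.subfield_iff(2)[OF class_ring.ring_axioms sub])
  have "abelian_group V"
    by (rule abelian_groupI)
      (auto simp: V add_combos add.assoc add.commute intro!: bexI[OF _ uminus_combos])
  then have "module (class_ring\<lparr>carrier := F\<rparr>) V"
    using F
    by (intro moduleI)
      (auto simp: V map_times_combos fieldE lookup_map_times lookup_add algebra_simps
        intro!: poly_mapping_eqI)
  then show ?thesis
    using F by (simp add: vectorspace_def)
qed

end

section \<open>Arrows of an abelian category\<close>

context linear_category
begin

lemma homsD: "f \<in> homs C X Y \<Longrightarrow> f \<in> Arr C \<and> Dom C f = X \<and> Cod C f = Y"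
  "f \<in> homs C X Y \<Longrightarrow> X \<in> Obj C" "f \<in> homs C X Y \<Longrightarrow> Y \<in> Obj C"
  using dom_cod by (auto simp: homs_def)

lemma arr_homs: "f \<in> Arr C \<Longrightarrow> f \<in> homs C (Dom C f) (Cod C f)"
  by (simp add: homs_def)

lemma abelian_group_hom_space: "X \<in> Obj C \<Longrightarrow> Y \<in> Obj C \<Longrightarrow> abelian_group (hom_space C X Y)"
  using hom_vectorspace by (auto simp: vectorspace_def module_def)

lemma null_homs: "X \<in> Obj C \<Longrightarrow> Y \<in> Obj C \<Longrightarrow> Null C X Y \<in> homs C X Y"
  using abelian_groupE(2)[OF abelian_group_hom_space, of X Y] by (simp add: hom_space_def)

lemma null_plus_null:
  assumes "X \<in> Obj C" "Y \<in> Obj C"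
  shows "Null C X Y \<boxplus> Null C X Y = Null C X Y"
  using abelian_groupE(5)[OF abelian_group_hom_space[OF assms], of "Null C X Y"] null_homs[OF assms]
  by (simp add: hom_space_def)

text \<open>Cancellation in the group of arrows from X to Y. By bilinearity, a composite with a zero
  arrow is equal to its own double, and this is how such composites are recognised as zero.\<close>

lemma idempotent_plus_is_null:
  assumes "f \<in> homs C X Y" "f \<boxplus> f = f"
  shows "f = Null C X Y"
proof -
  interpret G: abelian_group "hom_space C X Y"
    using assms homsD by (intro abelian_group_hom_space) blast+
  have "f \<oplus>\<^bsub>hom_space C X Y\<^esub> f = f" "f \<in> carrier (hom_space C X Y)"
    using assms by (simp_all add: hom_space_def)
  then have "f = \<zero>\<^bsub>hom_space C X Y\<^esub>"
    using G.add.l_cancel_one by blast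
  then show ?thesis by (simp add: hom_space_def)
qed

lemma comp_null_right:
  assumes "g \<in> homs C Y Z" "X \<in> Obj C"
  shows "g \<cdot> Null C X Y = Null C X Z"
proof (rule idempotent_plus_is_null)
  have Y: "Y \<in> Obj C" using assms homsD by blast
  note n = null_homs[OF assms(2) Y]
  show "g \<cdot> Null C X Y \<in> homs C X Z" by (rule comp[OF n assms(1)])
  show "(g \<cdot> Null C X Y) \<boxplus> (g \<cdot> Null C X Y) = g \<cdot> Null C X Y"
    using comp_plus_right[OF n n assms(1)] null_plus_null[OF assms(2) Y] by simp
qed

lemma comp_null_left:
  assumes "f \<in> homs C X Y" "Z \<in> Obj C"
  shows "Null C Y Z \<cdot> f = Null C X Z"
proof (rule idempotent_plus_is_null)
  have Y: "Y \<in> Obj C" using assms homsD by blast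
  note n = null_homs[OF Y assms(2)]
  show "Null C Y Z \<cdot> f \<in> homs C X Z" by (rule comp[OF assms(1) n])
  show "(Null C Y Z \<cdot> f) \<boxplus> (Null C Y Z \<cdot> f) = Null C Y Z \<cdot> f"
    using comp_plus_left[OF assms(1) n n] null_plus_null[OF Y assms(2)] by simp
qed

section \<open>Isomorphisms and isomorphism classes\<close>

lemma isomorphismI:
  assumes "u \<in> homs C X Y" "w \<in> homs C Y X" "w \<cdot> u = Ident C X" "u \<cdot> w = Ident C Y"
  shows "isomorphism C u"
  using assms by (auto simp: isomorphism_def homs_def)

lemma isomorphismE:
  assumes "isomorphism C u" "u \<in> homs C X Y"
  obtains w where "w \<in> homs C Y X" "w \<cdot> u = Ident C X" "u \<cdot> w = Ident C Y" "isomorphism C w"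
  using assms by (auto simp: isomorphism_def homs_def)

lemma isomorphism_Ident: "X \<in> Obj C \<Longrightarrow> isomorphism C (Ident C X)"
  using ident ident_left by (intro isomorphismI[of _ X X "Ident C X"]) blast+

lemma isomorphism_comp:
  assumes u: "u \<in> homs C X Y" "isomorphism C u" and v: "v \<in> homs C Y Z" "isomorphism C v"
  shows "isomorphism C (v \<cdot> u)"
proof -
  obtain u' where u': "u' \<in> homs C Y X" "u' \<cdot> u = Ident C X" "u \<cdot> u' = Ident C Y"
    using u isomorphismE by blast
  obtain v' where v': "v' \<in> homs C Z Y" "v' \<cdot> v = Ident C Y" "v \<cdot> v' = Ident C Z"
    using v isomorphismE by blast
  show ?thesis
  proof (rule isomorphismI)
    show vu: "v \<cdot> u \<in> homs C X Z" and uv': "u' \<cdot> v' \<in> homs C Z X"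
      using u v u' v' comp by blast+
    have "(u' \<cdot> v') \<cdot> (v \<cdot> u) = u' \<cdot> ((v' \<cdot> v) \<cdot> u)"
      using comp_assoc[OF vu v'(1) u'(1)] comp_assoc[OF u(1) v(1) v'(1)] by simp
    then show "(u' \<cdot> v') \<cdot> (v \<cdot> u) = Ident C X"
      using u' v' ident_left[OF u(1)] by simp
    have "(v \<cdot> u) \<cdot> (u' \<cdot> v') = v \<cdot> ((u \<cdot> u') \<cdot> v')"
      using comp_assoc[OF uv' u(1) v(1)] comp_assoc[OF v'(1) u'(1) u(1)] by simp
    then show "(v \<cdot> u) \<cdot> (u' \<cdot> v') = Ident C Z"
      using u' v' ident_left[OF v'(1)] by simp
  qed
qed

lemma iso_relI: "u \<in> homs C X Y \<Longrightarrow> isomorphism C u \<Longrightarrow> (X, Y) \<in> iso_rel C"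
  using homsD by (auto simp: iso_rel_def)

lemma iso_relE:
  assumes "(X, Y) \<in> iso_rel C"
  obtains u w where "u \<in> homs C X Y" "w \<in> homs C Y X" "w \<cdot> u = Ident C X" "u \<cdot> w = Ident C Y"
    "isomorphism C u" "isomorphism C w"
  using assms isomorphismE by (auto simp: iso_rel_def) metis

lemma equiv_iso_rel: "equiv (Obj C) (iso_rel C)"
proof (rule equivI)
  show "iso_rel C \<subseteq> Obj C \<times> Obj C" by (auto simp: iso_rel_def)
  show "refl_on (Obj C) (iso_rel C)"
    using ident isomorphism_Ident by (auto simp: refl_on_def intro: iso_relI)
  show "sym (iso_rel C)"
    by (rule symI) (metis iso_relE iso_relI)
  show "trans (iso_rel C)"
    by (rule transI) (metis comp iso_relE iso_relI isomorphism_comp)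
qed

lemma iso_rel_sym: "(X, Y) \<in> iso_rel C \<Longrightarrow> (Y, X) \<in> iso_rel C"
  using equiv_iso_rel by (meson equivE symE)

lemma iso_rel_trans: "(X, Y) \<in> iso_rel C \<Longrightarrow> (Y, Z) \<in> iso_rel C \<Longrightarrow> (X, Z) \<in> iso_rel C"
  using equiv_iso_rel by (meson equivE transE)

lemma iso_rel_refl: "X \<in> Obj C \<Longrightarrow> (X, X) \<in> iso_rel C"
  using equiv_iso_rel by (meson equivE refl_onD)

lemma rep_mem: "c \<in> Iso C \<Longrightarrow> rep c \<in> c"
  unfolding rep_def Iso_def
  by (rule someI_ex) (use equiv_iso_rel in_quotient_imp_non_empty in blast)

lemma rep_Obj: "c \<in> Iso C \<Longrightarrow> rep c \<in> Obj C"
  using rep_mem in_quotient_imp_subset[OF equiv_iso_rel] unfolding Iso_def by blast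

lemma Iso_eqI: "c \<in> Iso C \<Longrightarrow> d \<in> Iso C \<Longrightarrow> (rep c, rep d) \<in> iso_rel C \<Longrightarrow> c = d"
  using quotient_eqI[OF equiv_iso_rel] rep_mem unfolding Iso_def by blast

section \<open>Monics and cokernels\<close>

lemma monicI:
  assumes "i \<in> homs C X Y"
    "\<And>W g h. g \<in> homs C W X \<Longrightarrow> h \<in> homs C W X \<Longrightarrow> i \<cdot> g = i \<cdot> h \<Longrightarrow> g = h"
  shows "monic C i"
  using assms homsD(1)[OF assms(1)] by (auto simp: monic_def)

lemma monicD:
  "monic C i \<Longrightarrow> g \<in> homs C W (Dom C i) \<Longrightarrow> h \<in> homs C W (Dom C i) \<Longrightarrow> i \<cdot> g = i \<cdot> h \<Longrightarrow> g = h"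
  by (auto simp: monic_def)

lemma monic_homs: "monic C i \<Longrightarrow> i \<in> homs C (Dom C i) (Cod C i)"
  by (simp add: monic_def arr_homs)

lemma is_cokernel_homs:
  "is_cokernel C p f \<Longrightarrow> p \<in> homs C (Cod C f) (Cod C p)"
  by (simp add: is_cokernel_def homs_def)

text \<open>The common composite with p kills f because p does, and the universal property allows
  only one factorisation of it through p.\<close>

lemma is_cokernel_epic:
  assumes p: "is_cokernel C p f"
    and g: "g \<in> homs C (Cod C p) W" and h: "h \<in> homs C (Cod C p) W" and eq: "g \<cdot> p = h \<cdot> p"
  shows "g = h"
proof -
  have f: "f \<in> homs C (Dom C f) (Cod C f)" and pf: "p \<cdot> f = Null C (Dom C f) (Cod C p)"
    using p by (simp_all add: is_cokernel_def homs_def)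
  note ph = is_cokernel_homs[OF p]
  have "(g \<cdot> p) \<cdot> f = Null C (Dom C f) W"
    using comp_assoc[OF f ph g] comp_null_right[OF g] pf homsD(2)[OF f] by simp
  then have "\<exists>!u. u \<in> homs C (Cod C p) W \<and> u \<cdot> p = g \<cdot> p"
    using p comp[OF ph g] by (auto simp: is_cokernel_def)
  then show ?thesis using g h eq by metis
qed

lemma isomorphism_monic:
  assumes "u \<in> homs C X Y" "isomorphism C u"
  shows "monic C u"
proof -
  obtain w where w: "w \<in> homs C Y X" "w \<cdot> u = Ident C X" using assms isomorphismE by blast
  show ?thesis
  proof (rule monicI[OF assms(1)])
    fix W g h assume g: "g \<in> homs C W X" and h: "h \<in> homs C W X" and eq: "u \<cdot> g = u \<cdot> h"
    have "g = w \<cdot> (u \<cdot> g)" using comp_assoc[OF g assms(1) w(1)] w(2) ident_left[OF g] by simp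
    also have "\<dots> = h" using comp_assoc[OF h assms(1) w(1)] w(2) ident_left[OF h] eq by simp
    finally show "g = h" .
  qed
qed

section \<open>Zero objects\<close>

lemma zero_object_Obj: "zero_object C Z \<Longrightarrow> Z \<in> Obj C"
  by (simp add: zero_object_def)

lemma zero_object_into:
  "zero_object C Z \<Longrightarrow> f \<in> homs C X Z \<Longrightarrow> g \<in> homs C X Z \<Longrightarrow> f = g"
  using homsD(2) unfolding zero_object_def by metis

lemma zero_object_from:
  "zero_object C Z \<Longrightarrow> f \<in> homs C Z X \<Longrightarrow> g \<in> homs C Z X \<Longrightarrow> f = g"
  using homsD(3) unfolding zero_object_def by metis

text \<open>Composing any arrow into or out of X with the identity of X, which is zero, shows that
  the arrow itself is zero.\<close>

lemma zero_objectI: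
  assumes "X \<in> Obj C" "Ident C X = Null C X X"
  shows "zero_object C X"
  unfolding zero_object_def
proof (intro conjI ballI assms(1))
  fix Y assume Y: "Y \<in> Obj C"
  have "f = Null C Y X" if "f \<in> homs C Y X" for f
    using ident_left[OF that] comp_null_left[OF that assms(1)] assms(2) by simp
  then show "\<exists>!f. f \<in> homs C Y X"
    using null_homs[OF Y assms(1)] by blast
  have "f = Null C X Y" if "f \<in> homs C X Y" for f
    using ident_right[OF that] comp_null_right[OF that assms(1)] assms(2) by simp
  then show "\<exists>!f. f \<in> homs C X Y"
    using null_homs[OF assms(1) Y] by blast
qed

lemma zero_objects_iso:
  assumes "zero_object C Z" "zero_object C Z'"
  shows "isomorphism C (Null C Z Z')" "(Z, Z') \<in> iso_rel C"
proof -
  have n: "Null C Z Z' \<in> homs C Z Z'" "Null C Z' Z \<in> homs C Z' Z"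
    using assms by (simp_all add: null_homs zero_object_Obj)
  show "isomorphism C (Null C Z Z')"
  proof (rule isomorphismI[OF n])
    show "Null C Z' Z \<cdot> Null C Z Z' = Ident C Z"
      by (rule zero_object_into[OF assms(1) comp[OF n] ident[OF zero_object_Obj[OF assms(1)]]])
    show "Null C Z Z' \<cdot> Null C Z' Z = Ident C Z'"
      by (rule zero_object_into[OF assms(2) comp[OF n(2,1)] ident[OF zero_object_Obj[OF assms(2)]]])
  qed
  then show "(Z, Z') \<in> iso_rel C" by (rule iso_relI[OF n(1)])
qed

text \<open>The identity and the zero arrow of the source agree after composition with i, whose
  target is a zero object, and i can be cancelled. The statement on cokernels below is the dual
  argument.\<close>

lemma zero_object_monic_into:
  assumes "monic C i" "zero_object C (Cod C i)"
  shows "zero_object C (Dom C i)"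
proof -
  note i = monic_homs[OF assms(1)]
  have D: "Dom C i \<in> Obj C" by (rule homsD(2)[OF i])
  have "Ident C (Dom C i) = Null C (Dom C i) (Dom C i)"
    using zero_object_into[OF assms(2) comp[OF ident[OF D] i] comp[OF null_homs[OF D D] i]]
    by (rule monicD[OF assms(1) ident[OF D] null_homs[OF D D]])
  then show ?thesis by (rule zero_objectI[OF D])
qed

lemma zero_object_iso:
  assumes "zero_object C Z" "(X, Z) \<in> iso_rel C"
  shows "zero_object C X"
proof -
  obtain u where "u \<in> homs C X Z" "isomorphism C u" using assms iso_relE by metis
  then show ?thesis
    using zero_object_monic_into[OF isomorphism_monic] homsD(1) assms(1) by metis
qed

lemma zero_object_cokernel:
  assumes p: "is_cokernel C p f" and z: "zero_object C (Cod C f)"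
  shows "zero_object C (Cod C p)"
proof -
  note ph = is_cokernel_homs[OF p]
  have D: "Cod C p \<in> Obj C" by (rule homsD(3)[OF ph])
  have "Ident C (Cod C p) = Null C (Cod C p) (Cod C p)"
    using zero_object_from[OF z comp[OF ph ident[OF D]] comp[OF ph null_homs[OF D D]]]
    by (rule is_cokernel_epic[OF p ident[OF D] null_homs[OF D D]])
  then show ?thesis by (rule zero_objectI[OF D])
qed

lemma monic_from_zero_object:
  assumes "zero_object C Z" "f \<in> homs C Z X"
  shows "monic C f"
  by (rule monicI[OF assms(2)]) (rule zero_object_into[OF assms(1)])

text \<open>An arrow that kills u is zero, as composing with the inverse of u shows, and so it
  factors through Z in exactly one way.\<close>

lemma cokernel_of_iso:
  assumes u: "u \<in> homs C X Y" "isomorphism C u" and Z: "zero_object C Z"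
  shows "is_cokernel C (Null C Y Z) u"
proof -
  obtain w where w: "w \<in> homs C Y X" "u \<cdot> w = Ident C Y" using u isomorphismE by blast
  have Y: "Y \<in> Obj C" using u homsD by blast
  note n = null_homs[OF Y zero_object_Obj[OF Z]]
  have "\<exists>!t. t \<in> homs C Z W \<and> t \<cdot> Null C Y Z = g"
    if g: "g \<in> homs C Y W" and "g \<cdot> u = Null C X W" for W g
  proof -
    have W: "W \<in> Obj C" using g homsD by blast
    have "g = (g \<cdot> u) \<cdot> w" using comp_assoc[OF w(1) u(1) g] w(2) ident_right[OF g] by simp
    also have "\<dots> = Null C Y W" using that comp_null_left[OF w(1) W] by simp
    finally have "Null C Z W \<cdot> Null C Y Z = g" using comp_null_left[OF n W] by simp
    then show ?thesis
      using null_homs[OF zero_object_Obj[OF Z] W] zero_object_from[OF Z] by blast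
  qed
  then show ?thesis
    using homsD(1)[OF u(1)] homsD(1)[OF n] comp_null_left[OF u(1) zero_object_Obj[OF Z]]
    by (simp add: is_cokernel_def)
qed

lemma cokernel_from_zero_object:
  assumes "zero_object C Z" "f \<in> homs C Z X"
  shows "is_cokernel C (Ident C X) f"
proof -
  have X: "X \<in> Obj C" using assms homsD by blast
  have "\<exists>!t. t \<in> homs C X W \<and> t \<cdot> Ident C X = g" if "g \<in> homs C X W" for W g
    using that ident_right by metis
  moreover have "Ident C X \<cdot> f = Null C Z X"
    using ident_left[OF assms(2)] zero_object_from[OF assms null_homs[OF _ X]] zero_object_Obj assms
    by simp
  ultimately show ?thesis
    using homsD(1)[OF assms(2)] homsD(1)[OF ident[OF X]] by (simp add: is_cokernel_def)
qed

text \<open>The identity of the target kills f, hence factors through p. This gives a left inverse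
  of p, which is two-sided because p can be cancelled on the right.\<close>

lemma cokernel_iso_of_zero_source:
  assumes p: "is_cokernel C p f" and z: "zero_object C (Dom C f)"
  shows "(Cod C f, Cod C p) \<in> iso_rel C"
proof -
  note ph = is_cokernel_homs[OF p]
  let ?M = "Cod C f" and ?P = "Cod C p"
  have M: "?M \<in> Obj C" and P: "?P \<in> Obj C" using homsD[OF ph] by blast+
  have f: "f \<in> homs C (Dom C f) ?M" using p by (simp add: is_cokernel_def homs_def)
  have "Ident C ?M \<cdot> f = Null C (Dom C f) ?M"
    by (rule zero_object_from[OF z comp[OF f ident[OF M]] null_homs[OF zero_object_Obj[OF z] M]])
  then obtain u where u: "u \<in> homs C ?P ?M" "u \<cdot> p = Ident C ?M"
    using p ident[OF M] unfolding is_cokernel_def by metis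
  have "(p \<cdot> u) \<cdot> p = Ident C ?P \<cdot> p"
    using comp_assoc[OF ph u(1) ph] u(2) ident_right[OF ph] ident_left[OF ph] by simp
  then have "p \<cdot> u = Ident C ?P"
    by (rule is_cokernel_epic[OF p comp[OF u(1) ph] ident[OF P]])
  then show ?thesis
    using isomorphismI[OF ph u(1) u(2)] iso_relI[OF ph] by blast
qed

section \<open>Subobjects and Hall numbers with a zero subobject\<close>

lemma equiv_same_subobject: "equiv {i. monic C i} (same_subobject C)"
proof (rule equivI)
  show "same_subobject C \<subseteq> {i. monic C i} \<times> {i. monic C i}" by (auto simp: same_subobject_def)
  have "(i, i) \<in> same_subobject C" if "monic C i" for i
    using that homsD(2)[OF monic_homs] ident isomorphism_Ident ident_right[OF monic_homs[OF that]]
    unfolding same_subobject_def by fastforce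
  then show "refl_on {i. monic C i} (same_subobject C)" by (auto simp: refl_on_def)
  show "sym (same_subobject C)"
  proof (rule symI)
    fix i j assume "(i, j) \<in> same_subobject C"
    then obtain u where m: "monic C i" "monic C j" and u: "u \<in> homs C (Dom C i) (Dom C j)"
      "isomorphism C u" "i = j \<cdot> u"
      by (auto simp: same_subobject_def)
    obtain w where w: "w \<in> homs C (Dom C j) (Dom C i)" "u \<cdot> w = Ident C (Dom C j)"
      "isomorphism C w"
      using u isomorphismE by blast
    have "i \<cdot> w = j"
      using comp_assoc[OF w(1) u(1) monic_homs[OF m(2)]] w(2) ident_right[OF monic_homs[OF m(2)]] u(3)
      by simp
    then show "(j, i) \<in> same_subobject C"
      using m w by (auto simp: same_subobject_def)
  qed
  show "trans (same_subobject C)"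
  proof (rule transI)
    fix i j k assume "(i, j) \<in> same_subobject C" "(j, k) \<in> same_subobject C"
    then obtain u w where m: "monic C i" "monic C j" "monic C k"
      and u: "u \<in> homs C (Dom C i) (Dom C j)" "isomorphism C u" "i = j \<cdot> u"
      and w: "w \<in> homs C (Dom C j) (Dom C k)" "isomorphism C w" "j = k \<cdot> w"
      by (auto simp: same_subobject_def)
    have "i = k \<cdot> (w \<cdot> u)"
      using u(3) w(3) comp_assoc[OF u(1) w(1) monic_homs[OF m(3)]] by simp
    then show "(i, k) \<in> same_subobject C"
      using m comp[OF u(1) w(1)] isomorphism_comp[OF u(1,2) w(1,2)]
      by (auto simp: same_subobject_def)
  qed
qed

lemma hall_number_eq_1:
  assumes "i \<in> sub_monos C A B M"
    and "\<And>i j. i \<in> sub_monos C A B M \<Longrightarrow> j \<in> sub_monos C A B M \<Longrightarrow> (i, j) \<in> same_subobject C"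
  shows "hall_number C A B M = 1"
proof -
  have "sub_monos C A B M // same_subobject C = {same_subobject C `` {i}}"
    using assms equiv_class_eq[OF equiv_same_subobject] unfolding quotient_def by blast
  then show ?thesis by (simp add: hall_number_def)
qed

lemma hall_number_nonzeroE:
  assumes "hall_number C A B M \<noteq> 0"
  obtains i p where "monic C i" "Cod C i = M" "(Dom C i, B) \<in> iso_rel C"
    "is_cokernel C p i" "(Cod C p, A) \<in> iso_rel C"
proof -
  have "sub_monos C A B M \<noteq> {}"
    using assms by (auto simp: hall_number_def)
  then show thesis using that unfolding sub_monos_def by blast
qed

text \<open>An object has exactly one zero subobject, and the quotient by it is the object
  itself.\<close>

lemma hall_number_zero_sub:
  assumes Z: "zero_object C Z"
  shows "hall_number C A Z M \<noteq> 0 \<Longrightarrow> (M, A) \<in> iso_rel C"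
    and "(M, A) \<in> iso_rel C \<Longrightarrow> hall_number C A Z M = 1"
proof -
  assume "hall_number C A Z M \<noteq> 0"
  then obtain i p where ip: "monic C i" "Cod C i = M" "(Dom C i, Z) \<in> iso_rel C"
    "is_cokernel C p i" "(Cod C p, A) \<in> iso_rel C"
    by (rule hall_number_nonzeroE)
  then show "(M, A) \<in> iso_rel C"
    using cokernel_iso_of_zero_source[OF ip(4) zero_object_iso[OF Z ip(3)]] iso_rel_trans by metis
next
  assume MA: "(M, A) \<in> iso_rel C"
  then have M: "M \<in> Obj C" by (auto simp: iso_rel_def)
  note n = null_homs[OF zero_object_Obj[OF Z] M]
  show "hall_number C A Z M = 1"
  proof (rule hall_number_eq_1)
    show "Null C Z M \<in> sub_monos C A Z M"
      using monic_from_zero_object[OF Z n] cokernel_from_zero_object[OF Z n] MA homsD(1)[OF n]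
        homsD(1)[OF ident[OF M]] iso_rel_refl[OF zero_object_Obj[OF Z]]
      by (auto simp: sub_monos_def)
    fix i j assume "i \<in> sub_monos C A Z M" "j \<in> sub_monos C A Z M"
    then have i: "monic C i" "Cod C i = M" "zero_object C (Dom C i)"
      and j: "monic C j" "Cod C j = M" "zero_object C (Dom C j)"
      using zero_object_iso[OF Z] by (auto simp: sub_monos_def)
    let ?u = "Null C (Dom C i) (Dom C j)"
    have u: "?u \<in> homs C (Dom C i) (Dom C j)"
      using i j by (simp add: null_homs zero_object_Obj)
    have "i = j \<cdot> ?u"
      using zero_object_from[OF i(3) monic_homs[OF i(1)]] comp[OF u monic_homs[OF j(1)]] i j
      by simp
    then show "(i, j) \<in> same_subobject C"
      using i j u zero_objects_iso(1)[OF i(3) j(3)] by (auto simp: same_subobject_def)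
  qed
qed

end

section \<open>Zero quotients and the class of zero objects\<close>

context abelian_category
begin

text \<open>The monic i is the kernel of some g, and g factors through the cokernel p of i. What p
  kills is therefore killed by g and factors through i, so i is also the kernel of p.\<close>

lemma monic_short_exact:
  assumes m: "monic C i" and p: "is_cokernel C p i"
  shows "short_exact C i p"
proof -
  obtain g where g: "is_kernel C i g" using monic_is_kernel[OF m] by blast
  then have gi: "g \<in> homs C (Cod C i) (Cod C g)" "g \<cdot> i = Null C (Dom C i) (Cod C g)"
    by (auto simp: is_kernel_def homs_def)
  note ph = is_cokernel_homs[OF p]
  obtain u where u: "u \<in> homs C (Cod C p) (Cod C g)" "u \<cdot> p = g"
    using p gi unfolding is_cokernel_def by metis
  have "\<exists>!t. t \<in> homs C W (Dom C i) \<and> i \<cdot> t = h"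
    if h: "h \<in> homs C W (Dom C p)" and 0: "p \<cdot> h = Null C W (Cod C p)" for W h
  proof -
    have h': "h \<in> homs C W (Cod C i)" using h p by (simp add: is_cokernel_def)
    have W: "W \<in> Obj C" by (rule homsD(2)[OF h])
    have "g \<cdot> h = Null C W (Cod C g)"
      using comp_assoc[OF h' ph u(1)] u(2) 0 comp_null_right[OF u(1) W] by simp
    then show ?thesis using g h' unfolding is_kernel_def by metis
  qed
  then have "is_kernel C i p"
    using p by (auto simp: is_kernel_def is_cokernel_def)
  then show ?thesis using p by (simp add: short_exact_def)
qed

text \<open>The identity of the target is killed by p, hence factors through the kernel i of p. The
  resulting right inverse of i is two-sided because i is monic.\<close>

lemma monic_zero_cokernel_iso:
  assumes m: "monic C i" and p: "is_cokernel C p i" and z: "zero_object C (Cod C p)"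
  shows "isomorphism C i"
proof -
  let ?X = "Dom C i" and ?M = "Cod C i"
  note i = monic_homs[OF m] and ph = is_cokernel_homs[OF p]
  have X: "?X \<in> Obj C" and M: "?M \<in> Obj C" using homsD[OF i] by blast+
  have "p \<cdot> Ident C ?M = Null C ?M (Cod C p)"
    by (rule zero_object_into[OF z comp[OF ident[OF M] ph] null_homs[OF M zero_object_Obj[OF z]]])
  moreover have "is_kernel C i p" using monic_short_exact[OF m p] by (simp add: short_exact_def)
  ultimately obtain u where u: "u \<in> homs C ?M ?X" "i \<cdot> u = Ident C ?M"
    using ident[OF M] unfolding is_kernel_def by metis
  have "i \<cdot> (u \<cdot> i) = i \<cdot> Ident C ?X"
    using comp_assoc[OF i u(1) i] u(2) ident_right[OF i] ident_left[OF i] by simp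
  then have "u \<cdot> i = Ident C ?X"
    by (rule monicD[OF m comp[OF i u(1)] ident[OF X]])
  then show ?thesis using isomorphismI[OF i u(1)] u(2) by blast
qed

text \<open>Only the whole object M, as a subobject of itself, has zero quotient.\<close>

lemma hall_number_zero_quotient:
  assumes Z: "zero_object C Z"
  shows "hall_number C Z B M \<noteq> 0 \<Longrightarrow> (B, M) \<in> iso_rel C"
    and "(B, M) \<in> iso_rel C \<Longrightarrow> hall_number C Z B M = 1"
proof -
  assume "hall_number C Z B M \<noteq> 0"
  then obtain i p where ip: "monic C i" "Cod C i = M" "(Dom C i, B) \<in> iso_rel C"
    "is_cokernel C p i" "(Cod C p, Z) \<in> iso_rel C"
    by (rule hall_number_nonzeroE)
  have "isomorphism C i"
    using monic_zero_cokernel_iso[OF ip(1,4) zero_object_iso[OF Z ip(5)]] .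
  then show "(B, M) \<in> iso_rel C"
    using iso_relI[OF monic_homs[OF ip(1)]] ip(2,3) iso_rel_sym iso_rel_trans by metis
next
  assume "(B, M) \<in> iso_rel C"
  then obtain u where u: "u \<in> homs C B M" "isomorphism C u" using iso_relE by metis
  have B: "B \<in> Obj C" and M: "M \<in> Obj C" using homsD[OF u(1)] by blast+
  show "hall_number C Z B M = 1"
  proof (rule hall_number_eq_1)
    show "u \<in> sub_monos C Z B M"
      using isomorphism_monic[OF u] cokernel_of_iso[OF u Z] homsD(1)[OF u(1)]
        homsD(1)[OF null_homs[OF M zero_object_Obj[OF Z]]]
        iso_rel_refl[OF zero_object_Obj[OF Z]] iso_rel_refl[OF B]
      unfolding sub_monos_def by auto
    fix i j assume "i \<in> sub_monos C Z B M" "j \<in> sub_monos C Z B M"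
    then have i: "monic C i" "Cod C i = M" "isomorphism C i"
      and j: "monic C j" "Cod C j = M" "isomorphism C j"
      using zero_object_iso[OF Z] monic_zero_cokernel_iso unfolding sub_monos_def by blast+
    have ih: "i \<in> homs C (Dom C i) M" and jh: "j \<in> homs C (Dom C j) M"
      using monic_homs[OF i(1)] monic_homs[OF j(1)] i j by simp_all
    \<comment> \<open>Both monics are isomorphisms onto M, so the inverse of j compares their
      sources.\<close>
    obtain w where w: "w \<in> homs C M (Dom C j)" "j \<cdot> w = Ident C M" "isomorphism C w"
      using isomorphismE[OF j(3) jh] by blast
    have "j \<cdot> (w \<cdot> i) = i"
      using comp_assoc[OF ih w(1) jh] w(2) ident_left[OF ih] by simp
    then show "(i, j) \<in> same_subobject C"
      using i j comp[OF ih w(1)] isomorphism_comp[OF ih i(3) w(1,3)]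
      by (auto simp: same_subobject_def)
  qed
qed

text \<open>Subobjects and quotients of 0 vanish. In \<open>hatF\<close> with second argument 0 this
  forces L and I to be zero.\<close>

lemma hall_number_zero_total:
  assumes "zero_object C Z" "hall_number C A B Z \<noteq> 0"
  shows "zero_object C A" "zero_object C B"
proof -
  obtain i p where ip: "monic C i" "Cod C i = Z" "(Dom C i, B) \<in> iso_rel C"
    "is_cokernel C p i" "(Cod C p, A) \<in> iso_rel C"
    using assms(2) by (rule hall_number_nonzeroE)
  show "zero_object C A"
    using zero_object_iso[OF zero_object_cokernel[OF ip(4)] iso_rel_sym[OF ip(5)]] ip(2) assms(1)
    by simp
  show "zero_object C B"
    using zero_object_iso[OF zero_object_monic_into[OF ip(1)] iso_rel_sym[OF ip(3)]] ip(2) assms(1)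
    by simp
qed

text \<open>Zero objects are pairwise isomorphic, and anything isomorphic to one is again zero, so
  together they fill one class.\<close>

lemma zero_iso_class_Iso: "zero_iso_class C \<in> Iso C"
proof -
  obtain Z where Z: "zero_object C Z" using ex_zero_object by blast
  have "zero_iso_class C = iso_rel C `` {Z}"
    using zero_objects_iso(2)[OF Z] zero_object_iso[OF Z iso_rel_sym]
    by (auto simp: zero_iso_class_def)
  then show ?thesis
    using zero_object_Obj[OF Z] by (auto simp: Iso_def quotient_def)
qed

lemma zero_object_rep_iff: "c \<in> Iso C \<Longrightarrow> zero_object C (rep c) \<longleftrightarrow> c = zero_iso_class C"
  using rep_mem[OF zero_iso_class_Iso] zero_objects_iso(2) Iso_eqI[OF _ zero_iso_class_Iso]
  by (auto simp: zero_iso_class_def)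

end

section \<open>The Grothendieck group\<close>

lemma free_Abelian_group_torsion_free:
  assumes "x \<otimes>\<^bsub>free_Abelian_group S\<^esub> x = y \<otimes>\<^bsub>free_Abelian_group S\<^esub> y"
  shows "x = y"
proof (rule poly_mapping_eqI)
  fix k
  have "Poly_Mapping.lookup (x + x) k = Poly_Mapping.lookup (y + y) k"
    using assms by simp
  then show "Poly_Mapping.lookup x k = Poly_Mapping.lookup y k"
    by (simp add: lookup_add)
qed

text \<open>An isomorphism to a free abelian group is injective on the carrier and respects
  doubling; in the free group, doubles are compared coefficientwise in the integers.\<close>

lemma K0_free_torsion_free:
  assumes "K0_free C" "x \<in> carrier (K0 C)" "y \<in> carrier (K0 C)"
    and eq: "x \<otimes>\<^bsub>K0 C\<^esub> x = y \<otimes>\<^bsub>K0 C\<^esub> y"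
  shows "x = y"
proof -
  obtain S :: "('a \<Rightarrow>\<^sub>0 int) set set" and f where f: "f \<in> iso (K0 C) (free_Abelian_group S)"
    using assms(1) by (auto simp: K0_free_def is_iso_def)
  then have h: "f \<in> hom (K0 C) (free_Abelian_group S)" and inj: "inj_on f (carrier (K0 C))"
    by (auto simp: iso_def bij_betw_def)
  have "f x = f y"
    by (rule free_Abelian_group_torsion_free[of S])
      (simp only: eq flip: hom_mult[OF h assms(2,2)] hom_mult[OF h assms(3,3)])
  then show ?thesis using inj assms(2,3) by (auto dest: inj_onD)
qed

text \<open>Torsion-freeness gives the uniqueness on which the definite description behind
  \<open>K0_half\<close> depends.\<close>

lemma K0_half_eq:
  assumes "K0_free C" "d \<in> carrier (K0 C)" "d \<otimes>\<^bsub>K0 C\<^esub> d = x"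
  shows "K0_half C x = d"
  unfolding K0_half_def
proof (rule the_equality)
  show "d \<in> carrier (K0 C) \<and> d \<otimes>\<^bsub>K0 C\<^esub> d = x" using assms by simp
  show "e = d" if "e \<in> carrier (K0 C) \<and> e \<otimes>\<^bsub>K0 C\<^esub> e = x" for e
    by (rule K0_free_torsion_free[OF assms(1)]) (use that assms in simp_all)
qed

context linear_category
begin

abbreviation (input) "frees \<equiv> free_Abelian_group (Obj C)"

lemma short_exact_frag_mem:
  assumes "short_exact C i p"
  shows "frag_of (Cod C i) - frag_of (Dom C i) - frag_of (Cod C p) \<in> carrier frees"
proof -
  have "i \<in> Arr C" "p \<in> Arr C" using assms by (auto simp: short_exact_def is_kernel_def)
  then have "Cod C i \<in> Obj C" "Dom C i \<in> Obj C" "Cod C p \<in> Obj C" using dom_cod by blast+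
  then show ?thesis
    using keys_diff[of "frag_of (Cod C i) - frag_of (Dom C i)" "frag_of (Cod C p)"]
      keys_diff[of "frag_of (Cod C i)" "frag_of (Dom C i)"]
    by (auto simp: keys_frag_of)
qed

lemma subgroup_K0_relations: "subgroup (K0_relations C) frees"
  unfolding K0_relations_def
  by (rule group.generate_is_subgroup) (use short_exact_frag_mem in auto)

lemma normal_K0_relations: "K0_relations C \<lhd> frees"
  by (rule comm_group.subgroup_imp_normal[OF abelian_free_Abelian_group subgroup_K0_relations])

lemma comm_group_K0: "comm_group (K0 C)"
  unfolding K0_def
  by (rule comm_group.abelian_FactGroup[OF abelian_free_Abelian_group subgroup_K0_relations])

lemma K0_class_mem: "X \<in> Obj C \<Longrightarrow> K0_class C X \<in> carrier (K0 C)"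
  by (auto simp: K0_def K0_class_def carrier_FactGroup keys_frag_of)

lemma K0_class_short_exact:
  assumes s: "short_exact C i p"
  shows "K0_class C (Cod C i) = K0_class C (Cod C p) \<otimes>\<^bsub>K0 C\<^esub> K0_class C (Dom C i)"
proof -
  let ?x = "frag_of (Cod C i)" and ?y = "frag_of (Cod C p) + frag_of (Dom C i)"
  have "i \<in> Arr C" "p \<in> Arr C" using assms by (auto simp: short_exact_def is_kernel_def)
  then have o: "Cod C i \<in> Obj C" "Dom C i \<in> Obj C" "Cod C p \<in> Obj C" using dom_cod by blast+
  have y: "?y \<in> carrier frees"
    using o keys_add[of "frag_of (Cod C p)" "frag_of (Dom C i)"] by (auto simp: keys_frag_of)
  have "frag_of (Cod C i) - frag_of (Dom C i) - frag_of (Cod C p) \<in> K0_relations C"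
    unfolding K0_relations_def using s by (intro generate.incl) blast
  then have r: "?x - ?y \<in> K0_relations C" by (simp add: algebra_simps)
  have "?x \<in> K0_relations C #>\<^bsub>frees\<^esub> ?y"
    unfolding r_coset_def using r by (auto intro!: bexI[of _ "?x - ?y"])
  then have "K0_relations C #>\<^bsub>frees\<^esub> ?x = K0_relations C #>\<^bsub>frees\<^esub> ?y"
    using group.repr_independence[OF group_free_Abelian_group _ y subgroup_K0_relations] by metis
  also have "\<dots> = (K0_relations C #>\<^bsub>frees\<^esub> frag_of (Cod C p)) <#>\<^bsub>frees\<^esub>
      (K0_relations C #>\<^bsub>frees\<^esub> frag_of (Dom C i))"
    using normal.rcos_sum[OF normal_K0_relations, of "frag_of (Cod C p)" "frag_of (Dom C i)"] o
    by (simp add: keys_frag_of)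
  finally show ?thesis by (simp add: K0_class_def K0_def)
qed

lemma K0_class_zero_object:
  assumes Z: "zero_object C Z"
  shows "K0_class C Z = \<one>\<^bsub>K0 C\<^esub>"
proof -
  interpret K: comm_group "K0 C" by (rule comm_group_K0)
  let ?e = "Ident C Z"
  have e: "?e \<in> homs C Z Z" "isomorphism C ?e"
    using ident isomorphism_Ident zero_object_Obj[OF Z] by auto
  \<comment> \<open>On a zero object the identity is the zero arrow, hence its own kernel and
    cokernel. The sequence formed by two copies of it makes the class of Z idempotent.\<close>
  have "is_kernel C ?e ?e"
  proof -
    have "\<exists>!u. u \<in> homs C W Z \<and> ?e \<cdot> u = g" if "g \<in> homs C W Z" for W g
      using that ident_left by metis
    moreover have "?e \<cdot> ?e = Null C Z Z"
      by (rule zero_object_into[OF Z comp[OF e(1) e(1)]])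
        (simp add: null_homs zero_object_Obj[OF Z])
    ultimately show ?thesis
      using homsD(1)[OF e(1)] by (simp add: is_kernel_def)
  qed
  moreover have "is_cokernel C ?e ?e"
    using cokernel_from_zero_object[OF Z e(1)] .
  ultimately have "K0_class C Z = K0_class C Z \<otimes>\<^bsub>K0 C\<^esub> K0_class C Z"
    using K0_class_short_exact[of ?e ?e] homsD(1)[OF e(1)] unfolding short_exact_def by metis
  then show ?thesis
    using K.l_cancel_one K0_class_mem[OF zero_object_Obj[OF Z]] by metis
qed

end

context abelian_category
begin

text \<open>An isomorphism followed by the zero arrow to a zero object is a short exact sequence,
  whose third class is trivial.\<close>

lemma K0_class_iso:
  assumes "(X, Y) \<in> iso_rel C"
  shows "K0_class C X = K0_class C Y"
proof -
  interpret K: comm_group "K0 C" by (rule comm_group_K0)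
  obtain u where u: "u \<in> homs C X Y" "isomorphism C u" using assms iso_relE by metis
  obtain Z where Z: "zero_object C Z" using ex_zero_object by blast
  have XY: "X \<in> Obj C" "Y \<in> Obj C" using homsD[OF u(1)] by blast+
  have "short_exact C u (Null C Y Z)"
    by (rule monic_short_exact[OF isomorphism_monic[OF u] cokernel_of_iso[OF u Z]])
  from K0_class_short_exact[OF this] show ?thesis
    using homsD(1)[OF u(1)] homsD(1)[OF null_homs[OF XY(2) zero_object_Obj[OF Z]]]
      K0_class_zero_object[OF Z] K0_class_mem[OF XY(1)] by simp
qed

lemma K0_class_hall_number:
  assumes "hall_number C A B M \<noteq> 0"
  shows "K0_class C M = K0_class C A \<otimes>\<^bsub>K0 C\<^esub> K0_class C B"
proof -
  obtain i p where ip: "monic C i" "Cod C i = M" "(Dom C i, B) \<in> iso_rel C"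
    "is_cokernel C p i" "(Cod C p, A) \<in> iso_rel C"
    using assms by (rule hall_number_nonzeroE)
  show ?thesis
    using K0_class_short_exact[OF monic_short_exact[OF ip(1,4)]]
    unfolding ip(2) K0_class_iso[OF ip(3)] K0_class_iso[OF ip(5)] .
qed

end

section \<open>Structure constants\<close>

text \<open>A non-zero sum has a non-zero summand, whatever the size of the index set, because a sum
  over an infinite set is 0 by convention.\<close>

lemma hatF_nonzeroE:
  assumes "hatF C A B M \<noteq> 0"
  obtains L I N where "L \<in> Iso C" "I \<in> Iso C" "N \<in> Iso C"
    "hall_number C (rep L) (rep I) B \<noteq> 0" "hall_number C (rep N) (rep L) M \<noteq> 0"
    "hall_number C (rep I) (rep N) A \<noteq> 0"
  using assms unfolding hatF_def
  by (elim sum.not_neutral_contains_not_neutral) (auto intro: that)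

lemma subfield_Qv: "real_subfield (carrier (Qv C))"
  unfolding Qv_def
  by (rule real_subfield.intro) (simp add: field.generate_field_is_subfield[OF class_field])

lemma hall_v_mem_Qv: "hall_v C \<in> carrier (Qv C)"
  by (simp add: Qv_def generate_field.incl)

lemma hatF_mem_Qv: "hatF C A B M \<in> carrier (Qv C)"
proof -
  interpret real_subfield "carrier (Qv C)" by (rule subfield_Qv)
  show ?thesis
    unfolding hatF_def
    by (intro sum_mem) (auto intro!: times_mem divide_mem powi_mem of_nat_mem hall_v_mem_Qv)
qed

text \<open>The identity is an automorphism, and finiteness of the Hom set rules out the value 0
  that \<open>card\<close> takes on infinite sets.\<close>

lemma (in abelian_category) aut_card_nonzero:
  assumes "finitary C" "X \<in> Obj C"
  shows "aut_card C X \<noteq> 0"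
proof -
  have "finite {u \<in> homs C X X. isomorphism C u}"
    using assms by (auto simp: finitary_def)
  moreover have "Ident C X \<in> {u \<in> homs C X X. isomorphism C u}"
    using assms(2) ident isomorphism_Ident by blast
  ultimately show ?thesis unfolding aut_card_def by (metis card_eq_0_iff empty_iff)
qed

locale delta_hall_category = abelian_category C
  for C :: "('o, 'm, 'k::{field,finite}) lin_cat" (structure) +
  assumes finitary: "finitary C" and K0_free: "K0_free C"
begin

sublocale K: comm_group "K0 C"
  by (rule comm_group_K0)

text \<open>A triple \<open>(L, I, N)\<close> contributing to \<open>hatF C A B M\<close> gives \<open>A = I + N\<close>, \<open>B = L + I\<close> and
  \<open>M = N + L\<close> in \<open>K0 C\<close>, so that the class of \<open>I\<close> is the half of \<open>A + B - M\<close>.\<close>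

lemma K0_half_mem:
  assumes "hatF C A B M \<noteq> 0"
  shows "K0_half C (K0_class C A \<otimes>\<^bsub>K0 C\<^esub> K0_class C B \<otimes>\<^bsub>K0 C\<^esub> inv\<^bsub>K0 C\<^esub> K0_class C M)
    \<in> carrier (K0 C)"
proof -
  obtain L I N where LIN: "L \<in> Iso C" "I \<in> Iso C" "N \<in> Iso C"
    and h: "hall_number C (rep L) (rep I) B \<noteq> 0" "hall_number C (rep N) (rep L) M \<noteq> 0"
      "hall_number C (rep I) (rep N) A \<noteq> 0"
    using assms by (rule hatF_nonzeroE)
  let ?l = "K0_class C (rep L)" and ?i = "K0_class C (rep I)" and ?n = "K0_class C (rep N)"
  have c: "?l \<in> carrier (K0 C)" "?i \<in> carrier (K0 C)" "?n \<in> carrier (K0 C)"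
    using LIN by (simp_all add: K0_class_mem rep_Obj)
  have "(?i \<otimes>\<^bsub>K0 C\<^esub> ?n) \<otimes>\<^bsub>K0 C\<^esub> (?l \<otimes>\<^bsub>K0 C\<^esub> ?i) \<otimes>\<^bsub>K0 C\<^esub> inv\<^bsub>K0 C\<^esub> (?n \<otimes>\<^bsub>K0 C\<^esub> ?l)
      = (?i \<otimes>\<^bsub>K0 C\<^esub> ?i) \<otimes>\<^bsub>K0 C\<^esub> (?n \<otimes>\<^bsub>K0 C\<^esub> ?l) \<otimes>\<^bsub>K0 C\<^esub> inv\<^bsub>K0 C\<^esub> (?n \<otimes>\<^bsub>K0 C\<^esub> ?l)"
    using c by (simp add: K.m_ac)
  also have "\<dots> = ?i \<otimes>\<^bsub>K0 C\<^esub> ?i"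
    using c by (simp add: K.m_assoc del: K.inv_mult)
  finally show ?thesis
    using K0_half_eq[OF K0_free c(2), of "?i \<otimes>\<^bsub>K0 C\<^esub> ?i"] c(2)
      K0_class_hall_number[OF h(1)] K0_class_hall_number[OF h(2)] K0_class_hall_number[OF h(3)]
    by simp
qed

text \<open>In a contributing triple the factor with total object 0 makes L and I zero. The factor
  with subobject L then identifies N with M, and the one with quotient I identifies N with
  A.\<close>

lemma hatF_zero_right_nonzero_iff:
  assumes A: "A \<in> Iso C" and M: "M \<in> Iso C"
  shows "hatF C (rep A) (rep (zero_iso_class C)) (rep M) \<noteq> 0 \<longleftrightarrow> M = A"
proof
  let ?Z = "zero_iso_class C"
  have Z: "zero_object C (rep ?Z)"
    by (simp add: zero_object_rep_iff zero_iso_class_Iso)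
  have triple: "l = ?Z \<and> i = ?Z \<and> n = A \<and> n = M"
    if "l \<in> Iso C" "i \<in> Iso C" "n \<in> Iso C" "hall_number C (rep l) (rep i) (rep ?Z) \<noteq> 0"
      "hall_number C (rep n) (rep l) (rep M) \<noteq> 0" "hall_number C (rep i) (rep n) (rep A) \<noteq> 0"
    for l i n
  proof -
    have z: "zero_object C (rep l)" "zero_object C (rep i)"
      using hall_number_zero_total[OF Z that(4)] by blast+
    show ?thesis
      using z zero_object_rep_iff that(1,2)
        Iso_eqI[OF M that(3) hall_number_zero_sub(1)[OF z(1) that(5)]]
        Iso_eqI[OF that(3) A hall_number_zero_quotient(1)[OF z(2) that(6)]]
      by simp
  qed
  {
    assume "hatF C (rep A) (rep ?Z) (rep M) \<noteq> 0"
    then show "M = A" by (rule hatF_nonzeroE) (use triple in blast)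
  next
    assume MA: "M = A"
    have h: "hall_number C (rep ?Z) (rep ?Z) (rep ?Z) = 1"
      "hall_number C (rep A) (rep ?Z) (rep A) = 1" "hall_number C (rep ?Z) (rep A) (rep A) = 1"
      using hall_number_zero_sub(2)[OF Z] hall_number_zero_quotient(2)[OF Z] iso_rel_refl rep_Obj
        A zero_iso_class_Iso by simp_all
    \<comment> \<open>The sum has this one term, in which the Hall numbers are 1 and the power of v
      and the automorphism counts are non-zero.\<close>
    have *: "{(l, i, n). l \<in> Iso C \<and> i \<in> Iso C \<and> n \<in> Iso C \<and>
         hall_number C (rep l) (rep i) (rep ?Z) * hall_number C (rep n) (rep l) (rep M) *
         hall_number C (rep i) (rep n) (rep A) \<noteq> 0} = {(?Z, ?Z, A)}" (is "?S = _")
    proof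
      show "?S \<subseteq> {(?Z, ?Z, A)}"
        using triple by (clarsimp simp only: mult_eq_0_iff de_Morgan_disj) blast
      show "{(?Z, ?Z, A)} \<subseteq> ?S"
        using h A zero_iso_class_Iso by (simp add: MA)
    qed
    have "hall_v C \<noteq> 0" by (simp add: hall_v_def)
    then show "hatF C (rep A) (rep ?Z) (rep M) \<noteq> 0"
      using aut_card_nonzero[OF finitary rep_Obj[OF A]]
        aut_card_nonzero[OF finitary rep_Obj[OF zero_iso_class_Iso]]
      unfolding hatF_def * by (simp add: h MA)
  }
qed

end

section \<open>The forgetful map\<close>

context delta_hall_category
begin

sublocale coeff: real_subfield "carrier (Qv C)"
  by (rule subfield_Qv)

abbreviation "H \<equiv> delta_hall C"
abbreviation "HK \<equiv> ext_delta_hall C"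

section \<open>The two products as biadditive extensions from the basis\<close>

lemma hall_simps:
  "carrier H = coeff.combos (Iso C)" "add H = (+)" "zero H = 0"
  "smult H = (\<lambda>c. Poly_Mapping.map ((*) c))" "one H = Poly_Mapping.single (zero_iso_class C) 1"
  by (simp_all add: delta_hall_def coeff.combos_def)

lemma ext_hall_simps:
  "carrier HK = coeff.combos (Iso C \<times> carrier (K0 C))" "add HK = (+)" "zero HK = 0"
  "smult HK = (\<lambda>c. Poly_Mapping.map ((*) c))"
  "one HK = Poly_Mapping.single (zero_iso_class C, \<one>\<^bsub>K0 C\<^esub>) 1"
  by (simp_all add: ext_delta_hall_def coeff.combos_def)

text \<open>The coefficient c is an argument so that the product is additive in it, in the form that
  \<open>lin_ext\<close> expects.\<close>

definition basis_mult :: "'o set \<Rightarrow> 'o set \<Rightarrow> real \<Rightarrow> 'o set \<Rightarrow>\<^sub>0 real" where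
  "basis_mult A B c =
    (\<Sum>M\<in>{M \<in> Iso C. hatF C (rep A) (rep B) (rep M) \<noteq> 0}.
      Poly_Mapping.single M (c * hatF C (rep A) (rep B) (rep M)))"

definition K0_shift :: "'o set \<Rightarrow> 'o set \<Rightarrow> 'o set \<Rightarrow> ('o \<Rightarrow>\<^sub>0 int) set" where
  "K0_shift A B M = K0_half C (K0_class C (rep A) \<otimes>\<^bsub>K0 C\<^esub> K0_class C (rep B)
    \<otimes>\<^bsub>K0 C\<^esub> inv\<^bsub>K0 C\<^esub> K0_class C (rep M))"

definition ext_basis_mult ::
  "'o set \<times> ('o \<Rightarrow>\<^sub>0 int) set \<Rightarrow> 'o set \<times> ('o \<Rightarrow>\<^sub>0 int) set \<Rightarrow> real
    \<Rightarrow> ('o set \<times> ('o \<Rightarrow>\<^sub>0 int) set) \<Rightarrow>\<^sub>0 real" where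
  "ext_basis_mult p q c =
    (\<Sum>M\<in>{M \<in> Iso C. hatF C (rep (fst p)) (rep (fst q)) (rep M) \<noteq> 0}.
      Poly_Mapping.single
        (M, K0_shift (fst p) (fst q) M \<otimes>\<^bsub>K0 C\<^esub> snd p \<otimes>\<^bsub>K0 C\<^esub> snd q)
        (c * hatF C (rep (fst p)) (rep (fst q)) (rep M)))"

lemma mult_hall: "x \<otimes>\<^bsub>H\<^esub> y = lin_ext (\<lambda>A a. lin_ext (\<lambda>B b. basis_mult A B (a * b)) y) x"
  by (simp add: delta_hall_def lin_ext_def basis_mult_def)

lemma mult_ext_hall:
  "x \<otimes>\<^bsub>HK\<^esub> y = lin_ext (\<lambda>p a. lin_ext (\<lambda>q b. ext_basis_mult p q (a * b)) y) x"
  by (simp add: ext_delta_hall_def lin_ext_def ext_basis_mult_def K0_shift_def split_beta)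

lemma additive_basis_mult: "additive (basis_mult A B)"
  by (rule additive.intro) (simp add: basis_mult_def distrib_right single_add sum.distrib)

lemma additive_ext_basis_mult: "additive (ext_basis_mult p q)"
  by (rule additive.intro) (simp add: ext_basis_mult_def distrib_right single_add sum.distrib)

text \<open>Both products run over the same M with the same coefficients; the shift in K_0 sits
  entirely in the forgotten index.\<close>

lemma push_ext_basis_mult: "push fst (ext_basis_mult p q c) = basis_mult (fst p) (fst q) c"
  by (simp add: ext_basis_mult_def basis_mult_def push_sum)

lemma push_mult: "push fst (x \<otimes>\<^bsub>HK\<^esub> y) = push fst x \<otimes>\<^bsub>H\<^esub> push fst y"
proof -
  \<comment> \<open>Additivity in each of the two coefficients is the side condition for changing
    variables in the inner and then the outer sum.\<close>
  have 1: "additive (\<lambda>b. basis_mult A B (a * b))" for A B a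
    by (rule additive.intro) (simp add: distrib_left additive.add[OF additive_basis_mult])
  have 2: "additive (\<lambda>a. lin_ext (\<lambda>B b. basis_mult A B (a * b)) z)" for A z
    by (rule additive.intro)
      (simp add: lin_ext_def distrib_right additive.add[OF additive_basis_mult] sum.distrib)
  show ?thesis
    unfolding mult_hall mult_ext_hall
      lin_ext_push[of "\<lambda>A a. lin_ext (\<lambda>B b. basis_mult A B (a * b)) (push fst y)", OF 2]
    unfolding lin_ext_push[of "\<lambda>B b. basis_mult A B (a * b)" for A a, OF 1]
    by (simp add: push_lin_ext push_ext_basis_mult)
qed

text \<open>The sum ranges only over M with non-zero \<open>hatF\<close>, and for these the half in
  the exponent is a genuine element of K_0.\<close>

lemma mult_ext_hall_closed:
  assumes x: "x \<in> carrier HK" and y: "y \<in> carrier HK"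
  shows "x \<otimes>\<^bsub>HK\<^esub> y \<in> carrier HK"
proof -
  have "ext_basis_mult p q c \<in> carrier HK"
    if "snd p \<in> carrier (K0 C)" "snd q \<in> carrier (K0 C)" "c \<in> carrier (Qv C)" for p q c
    unfolding ext_hall_simps ext_basis_mult_def K0_shift_def
    by (intro coeff.sum_combos coeff.single_combos)
      (use that in \<open>auto simp: K0_half_mem hatF_mem_Qv coeff.times_mem\<close>)
  then show ?thesis
    using coeff.combosD[OF x[unfolded ext_hall_simps(1)]] coeff.combosD[OF y[unfolded ext_hall_simps(1)]]
    unfolding mult_ext_hall lin_ext_def ext_hall_simps(1)
    by (intro coeff.sum_combos) (simp add: coeff.times_mem mem_Times_iff)
qed

section \<open>Vector space structure and surjectivity\<close>

lemma Qv_class_ring: "Qv C = class_ring\<lparr>carrier := carrier (Qv C)\<rparr>"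
  by (simp add: Qv_def)

lemma vectorspace_hall: "vectorspace (Qv C) H"
  by (subst Qv_class_ring) (rule coeff.vectorspace_combos[OF hall_simps(1-4)])

lemma vectorspace_ext_hall: "vectorspace (Qv C) HK"
  by (subst Qv_class_ring) (rule coeff.vectorspace_combos[OF ext_hall_simps(1-4)])

lemma push_closed: "x \<in> carrier HK \<Longrightarrow> push fst x \<in> carrier H"
  unfolding hall_simps ext_hall_simps by (erule coeff.push_combos) auto

lemma push_surj: "push fst ` carrier HK = carrier H"
proof
  show "push fst ` carrier HK \<subseteq> carrier H" using push_closed by blast
  show "carrier H \<subseteq> push fst ` carrier HK"
  proof
    fix y assume y: "y \<in> carrier H"
    \<comment> \<open>The preimage is the value of the section that sends [M] to [M][K_0].\<close>
    let ?x = "push (\<lambda>M. (M, \<one>\<^bsub>K0 C\<^esub>)) y"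
    have "?x \<in> carrier HK"
      using y unfolding hall_simps ext_hall_simps by (rule coeff.push_combos) auto
    moreover have "push fst ?x = y"
      by (simp add: push_def[of "\<lambda>M. (M, \<one>\<^bsub>K0 C\<^esub>)"] push_lin_ext lin_ext_id)
    ultimately show "y \<in> push fst ` carrier HK" by force
  qed
qed

lemma algebra_epi_push: "algebra_epi (Qv C) HK H (push fst)"
proof -
  interpret V: vectorspace "Qv C" HK by (rule vectorspace_ext_hall)
  interpret W: vectorspace "Qv C" H by (rule vectorspace_hall)
  have "push fst \<in> module_hom (Qv C) HK H"
    using push_closed
    by (auto simp: module_hom_def ext_hall_simps(2,4) hall_simps(2,4) push_add push_map_times)
  then have "linear_map (Qv C) HK H (push fst)"
    by unfold_locales
  moreover have "push fst \<in> Ring.ring_hom HK H"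
    by (rule ring_hom_memI)
      (simp_all add: push_closed push_mult push_add ext_hall_simps(2,5) hall_simps(2,5))
  ultimately show ?thesis
    by (simp add: algebra_epi_def algebra_hom_def push_surj)
qed

section \<open>The kernel and the ideal of the elements [K_\<alpha>] - 1\<close>

lemma a_kernel_push: "a_kernel HK H (push fst) = {x \<in> carrier HK. push fst x = 0}"
  by (simp add: a_kernel_def' hall_simps(3))

lemma algebra_ideal_kernel: "algebra_ideal (Qv C) HK (a_kernel HK H (push fst))"
proof -
  interpret V: vectorspace "Qv C" HK by (rule vectorspace_ext_hall)
  have "LinearCombinations.submodule (Qv C) (a_kernel HK H (push fst)) HK"
    unfolding a_kernel_push
    by (rule LinearCombinations.submodule.intro)
      (use V.module_axioms V.M.a_closed V.M.zero_closed V.smult_closed in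
        \<open>auto simp: ext_hall_simps(2-4) push_add push_map_times\<close>)
  then show ?thesis
    by (auto simp: algebra_ideal_def a_kernel_push mult_ext_hall_closed push_mult)
      \<comment> \<open>What is left is that a product with a factor 0 vanishes: the sum over the
        support of that factor is empty.\<close>
      (simp_all add: mult_hall lin_ext_def)
qed

text \<open>The additive inverse of a record is described within its carrier; membership there
  identifies it with pointwise negation.\<close>

lemma minus_ext_hall:
  assumes "x \<in> carrier HK" "y \<in> carrier HK"
  shows "x \<ominus>\<^bsub>HK\<^esub> y = x - y"
proof -
  interpret V: vectorspace "Qv C" HK by (rule vectorspace_ext_hall)
  have "\<ominus>\<^bsub>HK\<^esub> y = - y"
    by (rule V.M.minus_equality)
      (use assms in \<open>simp_all add: ext_hall_simps coeff.uminus_combos\<close>)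
  then show ?thesis by (simp add: a_minus_def ext_hall_simps(2))
qed

lemma basis_mem:
  "M \<in> Iso C \<Longrightarrow> \<alpha> \<in> carrier (K0 C) \<Longrightarrow> c \<in> carrier (Qv C)
    \<Longrightarrow> Poly_Mapping.single (M, \<alpha>) c \<in> carrier HK"
  by (simp add: ext_hall_simps coeff.single_combos)

text \<open>Only the class M occurs in the product of [M] and [0], and the half of M + 0 - M is 0,
  so the exponent is \<alpha> alone.\<close>

lemma ext_basis_mult_K:
  assumes M: "M \<in> Iso C" and \<alpha>: "\<alpha> \<in> carrier (K0 C)"
  shows "ext_basis_mult (M, \<one>\<^bsub>K0 C\<^esub>) (zero_iso_class C, \<alpha>) c =
    Poly_Mapping.single (M, \<alpha>) (c * hatF C (rep M) (rep (zero_iso_class C)) (rep M))"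
proof -
  let ?Z = "zero_iso_class C"
  have "K0_class C (rep M) \<in> carrier (K0 C)" "K0_class C (rep ?Z) = \<one>\<^bsub>K0 C\<^esub>"
    using M K0_class_mem rep_Obj K0_class_zero_object zero_object_rep_iff zero_iso_class_Iso
    by simp_all
  then have "K0_shift M ?Z M = \<one>\<^bsub>K0 C\<^esub>"
    unfolding K0_shift_def by (intro K0_half_eq[OF K0_free]) simp_all
  moreover have "{N \<in> Iso C. hatF C (rep M) (rep ?Z) (rep N) \<noteq> 0} = {M}"
    using hatF_zero_right_nonzero_iff[OF M] M by auto
  ultimately show ?thesis
    using \<alpha> by (simp add: ext_basis_mult_def)
qed

text \<open>The constant k depends on M and not on \<alpha>, so both terms of [K_\<alpha>] - 1
  acquire the same factor.\<close>

lemma basis_mult_K_minus_one: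
  assumes M: "M \<in> Iso C" and \<alpha>: "\<alpha> \<in> carrier (K0 C)"
  defines "k \<equiv> hatF C (rep M) (rep (zero_iso_class C)) (rep M)"
  shows "Poly_Mapping.single (M, \<one>\<^bsub>K0 C\<^esub>) 1
      \<otimes>\<^bsub>HK\<^esub> (Poly_Mapping.single (zero_iso_class C, \<alpha>) 1 \<ominus>\<^bsub>HK\<^esub> \<one>\<^bsub>HK\<^esub>)
    = Poly_Mapping.single (M, \<alpha>) k - Poly_Mapping.single (M, \<one>\<^bsub>K0 C\<^esub>) k"
proof -
  let ?Z = "zero_iso_class C" and ?p = "(M, \<one>\<^bsub>K0 C\<^esub>)"
  have "Poly_Mapping.single (?Z, \<alpha>) 1 \<ominus>\<^bsub>HK\<^esub> \<one>\<^bsub>HK\<^esub>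
      = Poly_Mapping.single (?Z, \<alpha>) 1 - Poly_Mapping.single (?Z, \<one>\<^bsub>K0 C\<^esub>) 1"
    by (simp add: minus_ext_hall basis_mem zero_iso_class_Iso \<alpha> ext_hall_simps(5))
  then have "Poly_Mapping.single ?p 1
      \<otimes>\<^bsub>HK\<^esub> (Poly_Mapping.single (?Z, \<alpha>) 1 \<ominus>\<^bsub>HK\<^esub> \<one>\<^bsub>HK\<^esub>)
    = lin_ext (ext_basis_mult ?p)
        (Poly_Mapping.single (?Z, \<alpha>) 1 - Poly_Mapping.single (?Z, \<one>\<^bsub>K0 C\<^esub>) 1)"
    unfolding mult_ext_hall by (simp add: lin_ext_def[of _ "Poly_Mapping.single ?p 1"])
  also have "\<dots> = ext_basis_mult ?p (?Z, \<alpha>) 1 - ext_basis_mult ?p (?Z, \<one>\<^bsub>K0 C\<^esub>) 1"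
    by (simp add: lin_ext_diff lin_ext_single additive_ext_basis_mult)
  finally show ?thesis
    by (simp add: ext_basis_mult_K M \<alpha> k_def)
qed

text \<open>Stated for an arbitrary ideal containing the generators, which is what a lower bound for
  the intersection \<open>generated_ideal\<close> requires.\<close>

lemma kernel_subset_ideal:
  assumes I: "algebra_ideal (Qv C) HK I"
    and gens: "\<And>\<alpha>. \<alpha> \<in> carrier (K0 C)
      \<Longrightarrow> Poly_Mapping.single (zero_iso_class C, \<alpha>) 1 \<ominus>\<^bsub>HK\<^esub> \<one>\<^bsub>HK\<^esub> \<in> I"
  shows "a_kernel HK H (push fst) \<subseteq> I"
proof
  interpret I: LinearCombinations.submodule "Qv C" I HK
    using I by (simp add: algebra_ideal_def)
  let ?d = "\<lambda>p c. Poly_Mapping.single p c - Poly_Mapping.single (fst p, \<one>\<^bsub>K0 C\<^esub>) (c::real)"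
  have d: "?d (M, \<alpha>) c \<in> I"
    if M: "M \<in> Iso C" and \<alpha>: "\<alpha> \<in> carrier (K0 C)" and c: "c \<in> carrier (Qv C)" for M \<alpha> c
  proof -
    let ?k = "hatF C (rep M) (rep (zero_iso_class C)) (rep M)"
    have k: "?k \<noteq> 0" using hatF_zero_right_nonzero_iff[OF M M] by simp
    have "Poly_Mapping.single (M, \<alpha>) ?k - Poly_Mapping.single (M, \<one>\<^bsub>K0 C\<^esub>) ?k \<in> I"
      using I gens[OF \<alpha>] basis_mem[OF M K.one_closed coeff.one_mem]
      unfolding algebra_ideal_def basis_mult_K_minus_one[OF M \<alpha>, symmetric] by blast
    \<comment> \<open>The scalar turns the coefficient k into the prescribed c; it is admissible
      because k lies in Q(v).\<close>
    then have "Poly_Mapping.map ((*) (c / ?k))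
        (Poly_Mapping.single (M, \<alpha>) ?k - Poly_Mapping.single (M, \<one>\<^bsub>K0 C\<^esub>) ?k) \<in> I"
      using I.smult_closed[of "c / ?k"] c coeff.divide_mem[OF c hatF_mem_Qv]
      by (simp add: ext_hall_simps(4))
    also have "Poly_Mapping.map ((*) (c / ?k))
        (Poly_Mapping.single (M, \<alpha>) ?k - Poly_Mapping.single (M, \<one>\<^bsub>K0 C\<^esub>) ?k) = ?d (M, \<alpha>) c"
      by (rule poly_mapping_eqI)
        (simp add: lookup_map_times lookup_minus lookup_single when_def k)
    finally show ?thesis .
  qed
  have sums: "(\<Sum>p\<in>A. u p) \<in> I" if "\<And>p. p \<in> A \<Longrightarrow> u p \<in> I"
    for A and u :: "'o set \<times> ('o \<Rightarrow>\<^sub>0 int) set \<Rightarrow> _"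
    using that I.m_closed I.zero_closed
    by (induction A rule: infinite_finite_induct) (simp_all add: ext_hall_simps(2,3))
  fix x assume "x \<in> a_kernel HK H (push fst)"
  then have x: "x \<in> carrier HK" and ker: "push fst x = 0"
    by (simp_all add: a_kernel_push)
  \<comment> \<open>This is the section applied to the image of x. It vanishes on the kernel, so
    subtracting it from x writes x as a sum of differences \<open>?d\<close>.\<close>
  have "lin_ext (\<lambda>p. Poly_Mapping.single (fst p, \<one>\<^bsub>K0 C\<^esub>)) x
      = lin_ext (\<lambda>M. Poly_Mapping.single (M, \<one>\<^bsub>K0 C\<^esub>)) (push fst x)"
    by (simp add: lin_ext_push additive_single)
  also have "\<dots> = 0" by (simp add: ker)
  finally have "x = lin_ext Poly_Mapping.single x
      - lin_ext (\<lambda>p. Poly_Mapping.single (fst p, \<one>\<^bsub>K0 C\<^esub>)) x"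
    by (simp add: lin_ext_id)
  also have "\<dots> = (\<Sum>p\<in>Poly_Mapping.keys x. ?d p (Poly_Mapping.lookup x p))"
    by (simp add: lin_ext_def sum_subtractf)
  also have "\<dots> \<in> I"
  proof (rule sums)
    fix p assume "p \<in> Poly_Mapping.keys x"
    then have "fst p \<in> Iso C" "snd p \<in> carrier (K0 C)" "Poly_Mapping.lookup x p \<in> carrier (Qv C)"
      using coeff.combosD[OF x[unfolded ext_hall_simps(1)]] by (auto simp: mem_Times_iff)
    from d[OF this] show "?d p (Poly_Mapping.lookup x p) \<in> I" by simp
  qed
  finally show "x \<in> I" .
qed

text \<open>The kernel lies in every ideal containing the generators, and is itself such an ideal,
  since [K_\<alpha>] and 1 both map to [0].\<close>

lemma a_kernel_push_eq_generated_ideal: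
  "a_kernel HK H (push fst) = generated_ideal (Qv C) HK
    {Poly_Mapping.single (zero_iso_class C, \<alpha>) 1 \<ominus>\<^bsub>HK\<^esub> \<one>\<^bsub>HK\<^esub> | \<alpha>. \<alpha> \<in> carrier (K0 C)}"
    (is "_ = generated_ideal _ _ ?S")
proof
  show "a_kernel HK H (push fst) \<subseteq> generated_ideal (Qv C) HK ?S"
    unfolding generated_ideal_def using kernel_subset_ideal by blast
  interpret V: vectorspace "Qv C" HK by (rule vectorspace_ext_hall)
  have "?S \<subseteq> a_kernel HK H (push fst)"
  proof
    fix s assume "s \<in> ?S"
    then obtain \<alpha> where \<alpha>: "\<alpha> \<in> carrier (K0 C)"
      and s: "s = Poly_Mapping.single (zero_iso_class C, \<alpha>) 1 \<ominus>\<^bsub>HK\<^esub> \<one>\<^bsub>HK\<^esub>"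
      by blast
    have b: "Poly_Mapping.single (zero_iso_class C, \<beta>) 1 \<in> carrier HK"
      if "\<beta> \<in> carrier (K0 C)" for \<beta>
      using that by (simp add: basis_mem zero_iso_class_Iso)
    have "s \<in> carrier HK"
      unfolding s ext_hall_simps(5) using b \<alpha> by (intro V.M.minus_closed) simp_all
    moreover have "push fst s = 0"
      unfolding s ext_hall_simps(5) using b \<alpha> by (simp add: minus_ext_hall push_diff)
    ultimately show "s \<in> a_kernel HK H (push fst)" by (simp add: a_kernel_push)
  qed
  then show "generated_ideal (Qv C) HK ?S \<subseteq> a_kernel HK H (push fst)"
    unfolding generated_ideal_def using algebra_ideal_kernel by blast
qed

end

theorem proposition4p6:
  fixes C :: "('o, 'm, 'k::{field,finite}) lin_cat"
  assumes "abelian_category C"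
    and "hereditary C"
    and "finitary C"
    and "K0_free C"
  shows "\<exists>\<Phi>. algebra_epi (Qv C) (ext_delta_hall C) (delta_hall C) \<Phi> \<and>
    (\<forall>M\<in>Iso C. \<forall>\<alpha>\<in>carrier (K0 C).
       \<Phi> (Poly_Mapping.single (M, \<alpha>) 1) = Poly_Mapping.single M 1) \<and>
    a_kernel (ext_delta_hall C) (delta_hall C) \<Phi> =
      generated_ideal (Qv C) (ext_delta_hall C)
        {Poly_Mapping.single (zero_iso_class C, \<alpha>) 1 \<ominus>\<^bsub>ext_delta_hall C\<^esub> \<one>\<^bsub>ext_delta_hall C\<^esub>
          | \<alpha>. \<alpha> \<in> carrier (K0 C)}"
proof -
  interpret delta_hall_category C
    using assms by (intro delta_hall_category.intro delta_hall_category_axioms.intro)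
  show ?thesis
    using algebra_epi_push a_kernel_push_eq_generated_ideal by (intro exI[of _ "push fst"]) simp
qed

end
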